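(* Let $F(X)$ be the free group on a finite set $X$ and let $K$ be a finitely generated subgroup of $F(X)$. Then $K$ is algebraically closed in $F(X)$ if and only if $K$ is a free factor of $F(X)$, that is, $F(X)=K*C$ for some $C\le F(X)$.
   Context: Let $K \le H \le F(X)$. $H$ is a free extension of $K$ if there are subgroups $C \ne 1$ and $K'$ of $F(X)$ such that $K \le K'$ and $H = K' * C$ (internal free product). If $K \le H$ is not a free extension, it is called an algebraic extension. For a finitely generated $K\le F(X)$ there is a largest algebraic extension of $K$ in $F(X)$ (one which contains all the others); it is called the algebraic closure of $K$ and denoted $cl(K)$. The subgroup $K$ is algebraically closed in $F(X)$ if $K=cl(K)$. *)

theory Defs
  imports "HOL-Algebra.Generated_Groups"
begin

text \<open>
  The free group \<open>F(X)\<close> is realised on the freely reduced words over the letters \<open>x\<close> and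
  \<open>x\<inverse>\<close> with \<open>x \<in> X\<close>, encoded as \<open>(x, True)\<close> and \<open>(x, False)\<close>.  Multiplication is
  concatenation followed by free reduction.
\<close>

type_synonym 'x word = "('x \<times> bool) list"

definition inv_letter :: "'x \<times> bool \<Rightarrow> 'x \<times> bool"
  where "inv_letter a = (fst a, \<not> snd a)"

definition freely_reduced :: "'x word \<Rightarrow> bool"
  where "freely_reduced w \<longleftrightarrow> successively (\<lambda>a b. b \<noteq> inv_letter a) w"

fun push_letter :: "'x \<times> bool \<Rightarrow> 'x word \<Rightarrow> 'x word" where
  "push_letter a [] = [a]"
| "push_letter a (b # w) = (if b = inv_letter a then w else a # b # w)"

definition free_group :: "'x set \<Rightarrow> 'x word monoid"
  where "free_group X =
    \<lparr>carrier = {w. set w \<subseteq> X \<times> UNIV \<and> freely_reduced w},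
     mult = (\<lambda>u v. foldr push_letter u v),
     one = []\<rparr>"

lemma inv_letter_inv_letter [simp]: "inv_letter (inv_letter a) = a"
  by (simp add: inv_letter_def)

lemma fst_inv_letter [simp]: "fst (inv_letter a) = fst a"
  by (simp add: inv_letter_def)

lemma freely_reduced_push: "freely_reduced w \<Longrightarrow> freely_reduced (push_letter a w)"
  by (cases w) (auto simp: freely_reduced_def successively_Cons)

lemma freely_reduced_foldr_push:
  "freely_reduced w \<Longrightarrow> freely_reduced (foldr push_letter u w)"
  by (induction u) (auto simp: freely_reduced_push)

lemma push_letter_cancel:
  "freely_reduced w \<Longrightarrow> push_letter a (push_letter (inv_letter a) w) = w"
  by (cases w rule: remdups_adj.cases) (auto simp: freely_reduced_def successively_Cons)

lemma set_push_letter: "set (push_letter a w) \<subseteq> insert a (set w)"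
  by (cases w) auto

lemma set_foldr_push: "set (foldr push_letter u w) \<subseteq> set u \<union> set w"
proof (induction u)
  case (Cons a u)
  then show ?case using set_push_letter[of a "foldr push_letter u w"] by auto
qed simp

lemma foldr_push_push:
  assumes "freely_reduced w"
  shows "foldr push_letter (push_letter a u) w = push_letter a (foldr push_letter u w)"
proof (cases u)
  case (Cons b v)
  then show ?thesis
    using push_letter_cancel[OF freely_reduced_foldr_push[OF assms], of a v] by auto
qed simp

lemma foldr_push_assoc:
  assumes "freely_reduced w"
  shows "foldr push_letter (foldr push_letter u v) w
    = foldr push_letter u (foldr push_letter v w)"
  by (induction u) (simp_all add: foldr_push_push[OF assms])

lemma freely_reduced_inverse:
  assumes "freely_reduced w"
  shows "freely_reduced (map inv_letter (rev w))"
  using assms unfolding freely_reduced_def successively_map successively_rev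
  by (rule successively_mono) (metis inv_letter_inv_letter)

lemma foldr_push_inverse: "foldr push_letter (map inv_letter (rev w)) w = []"
  by (induction w) auto

lemma group_free_group: "group (free_group X)"
proof (rule groupI)
  fix u v assume "u \<in> carrier (free_group X)" "v \<in> carrier (free_group X)"
  then show "u \<otimes>\<^bsub>free_group X\<^esub> v \<in> carrier (free_group X)"
    using set_foldr_push[of u v] by (auto simp: free_group_def freely_reduced_foldr_push)
next
  fix u assume u: "u \<in> carrier (free_group X)"
  have "map inv_letter (rev u) \<in> carrier (free_group X)"
    using u by (auto simp: free_group_def freely_reduced_inverse inv_letter_def)
  moreover have "map inv_letter (rev u) \<otimes>\<^bsub>free_group X\<^esub> u = \<one>\<^bsub>free_group X\<^esub>"
    by (simp add: free_group_def foldr_push_inverse)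
  ultimately show "\<exists>v\<in>carrier (free_group X). v \<otimes>\<^bsub>free_group X\<^esub> u = \<one>\<^bsub>free_group X\<^esub>"
    by blast
qed (auto simp: free_group_def freely_reduced_def foldr_push_assoc)

definition finitely_generated_subgroup :: "('a, 'm) monoid_scheme \<Rightarrow> 'a set \<Rightarrow> bool"
  where "finitely_generated_subgroup G K \<longleftrightarrow>
    (\<exists>S. finite S \<and> S \<subseteq> carrier G \<and> K = generate G S)"

text \<open>
  The elements of the (external) free product of \<open>A\<close> and \<open>B\<close> in normal form: words of nontrivial
  elements of the factors in which neighbouring syllables come from different factors.  Each
  syllable carries the tag of its factor (\<open>True\<close> for \<open>A\<close>, \<open>False\<close> for \<open>B\<close>), so that the words are
  formed from the disjoint union of \<open>A\<close> and \<open>B\<close> even if these meet in \<open>G\<close>.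
\<close>

definition alternating_words ::
    "('a, 'm) monoid_scheme \<Rightarrow> 'a set \<Rightarrow> 'a set \<Rightarrow> (bool \<times> 'a) list set"
  where "alternating_words G A B =
    {w. (\<forall>(t, g)\<in>set w. g \<in> (if t then A else B) - {\<one>\<^bsub>G\<^esub>})
        \<and> successively (\<lambda>p q. fst p \<noteq> fst q) w}"

definition word_product :: "('a, 'm) monoid_scheme \<Rightarrow> (bool \<times> 'a) list \<Rightarrow> 'a"
  where "word_product G w = foldr (\<lambda>p g. snd p \<otimes>\<^bsub>G\<^esub> g) w \<one>\<^bsub>G\<^esub>"

text \<open>
  \<open>H = A * B\<close>: the canonical map from the free product of the subgroups \<open>A\<close> and \<open>B\<close> into \<open>G\<close> is
  injective with image \<open>H\<close>.
\<close>

definition internal_free_product ::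
    "('a, 'm) monoid_scheme \<Rightarrow> 'a set \<Rightarrow> 'a set \<Rightarrow> 'a set \<Rightarrow> bool"
  where "internal_free_product G H A B \<longleftrightarrow>
    subgroup H G \<and> subgroup A G \<and> subgroup B G
    \<and> bij_betw (word_product G) (alternating_words G A B) H"

definition free_factor :: "('a, 'm) monoid_scheme \<Rightarrow> 'a set \<Rightarrow> bool"
  where "free_factor G K \<longleftrightarrow>
    (\<exists>C. subgroup C G \<and> internal_free_product G (carrier G) K C)"

definition free_extension :: "('a, 'm) monoid_scheme \<Rightarrow> 'a set \<Rightarrow> 'a set \<Rightarrow> bool"
  where "free_extension G K H \<longleftrightarrow>
    subgroup K G \<and> subgroup H G \<and> K \<subseteq> H
    \<and> (\<exists>C K'. subgroup C G \<and> subgroup K' G \<and> C \<noteq> {\<one>\<^bsub>G\<^esub>} \<and> K \<subseteq> K'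
          \<and> internal_free_product G H K' C)"

definition algebraic_extension :: "('a, 'm) monoid_scheme \<Rightarrow> 'a set \<Rightarrow> 'a set \<Rightarrow> bool"
  where "algebraic_extension G K H \<longleftrightarrow>
    subgroup K G \<and> subgroup H G \<and> K \<subseteq> H \<and> \<not> free_extension G K H"

text \<open>
  The largest algebraic extension with respect to inclusion.  As with every use of
  \<^const>\<open>Greatest\<close>, the value is only meaningful when such an extension exists, which is the case
  for finitely generated \<open>K\<close> in a free group.
\<close>

definition algebraic_closure :: "('a, 'm) monoid_scheme \<Rightarrow> 'a set \<Rightarrow> 'a set"
  where "algebraic_closure G K = (GREATEST H. algebraic_extension G K H)"

definition algebraically_closed :: "('a, 'm) monoid_scheme \<Rightarrow> 'a set \<Rightarrow> bool"
  where "algebraically_closed G K \<longleftrightarrow> K = algebraic_closure G K"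

end

(* Among the free factors of F(X) containing K choose one, L, of minimal rank.  By minimality L is
   an algebraic extension of K: a splitting L = M * C with K <= M and C nontrivial would make M a
   free factor of smaller rank.  If H is any algebraic extension of K, then H = (H \<inter> L) * D for
   some D, as L is a free factor of F(X) (a case of Kurosh's subgroup theorem); hence D = 1 and
   H <= L.  So cl(K) = L, and K = cl(K) holds exactly when K is itself a free factor.  The splitting
   of H comes from a Schreier transversal that first represents the cosets of H meeting L: its
   Schreier basis of H contains a basis of H \<inter> L. *)

theory Submission imports Defs begin

section \<open>Evaluation of words and free bases\<close>

text \<open>A free factor is spanned by a part \<open>S\<close> of some basis of F(X), so everything
  is done over an arbitrary basis and not only over \<open>X\<close>. The obstacle is to find a
  basis of \<open>H \<inter> L\<close> inside a basis of \<open>H\<close>. Schreier's construction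
  makes the right cosets of \<open>H\<close> into a graph and reads generators off the edges outside
  a spanning tree. A walk from \<open>H\<close> with letters of \<open>S\<close> stays among the
  cosets meeting \<open>L\<close>; if the tree restricts to a spanning tree of that piece, then
  rewriting an element of \<open>H \<inter> L\<close> emits only generators of edges of the piece.
  Freeness is shown without topology: a transducer rewrites words along the graph and inverts
  evaluation. For empty \<open>S\<close> this is the Nielsen-Schreier theorem, which gives every
  factor a basis, so that free products can be handled as disjoint unions of bases. Ranks are
  compared by counting homomorphisms to the group of order two.\<close>

abbreviation words :: "'y set \<Rightarrow> 'y word set"
  where "words Y \<equiv> carrier (free_group Y)"

definition letter_value :: "('g, 'm) monoid_scheme \<Rightarrow> ('y \<Rightarrow> 'g) \<Rightarrow> 'y \<times> bool \<Rightarrow> 'g"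
  where "letter_value G f a = (if snd a then f (fst a) else inv\<^bsub>G\<^esub> f (fst a))"

definition eval_word :: "('g, 'm) monoid_scheme \<Rightarrow> ('y \<Rightarrow> 'g) \<Rightarrow> 'y word \<Rightarrow> 'g"
  where "eval_word G f w = foldr (\<lambda>a g. letter_value G f a \<otimes>\<^bsub>G\<^esub> g) w \<one>\<^bsub>G\<^esub>"

text \<open>A basis is an indexed family, so that letters need not be group elements: the set
  \<open>X\<close> indexes the standard basis of F(X), while Schreier bases are sets of group
  elements, used with the identity as \<open>f\<close>. Surjectivity onto \<open>A\<close> is
  generation, injectivity is freeness.\<close>

definition free_basis :: "('g, 'm) monoid_scheme \<Rightarrow> ('y \<Rightarrow> 'g) \<Rightarrow> 'y set \<Rightarrow> 'g set \<Rightarrow> bool"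
  where "free_basis G f Y A \<longleftrightarrow>
    f ` Y \<subseteq> carrier G \<and> bij_betw (eval_word G f) (words Y) A"

lemma words_iff: "w \<in> words Y \<longleftrightarrow> set w \<subseteq> Y \<times> UNIV \<and> freely_reduced w"
  by (simp add: free_group_def)

lemma mult_free_group: "u \<otimes>\<^bsub>free_group Y\<^esub> v = foldr push_letter u v"
  by (simp add: free_group_def)

lemma one_free_group: "\<one>\<^bsub>free_group Y\<^esub> = []"
  by (simp add: free_group_def)

lemma freely_reduced_Nil [simp]: "freely_reduced []"
  by (simp add: freely_reduced_def)

lemma freely_reduced_singleton [simp]: "freely_reduced [a]"
  by (simp add: freely_reduced_def)

lemma foldr_push_reduced: "freely_reduced w \<Longrightarrow> foldr push_letter w [] = w"
proof (induction w)
  case (Cons a w)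
  then show ?case by (cases w) (auto simp: freely_reduced_def)
qed simp

lemma foldr_push_in_words:
  assumes "set u \<subseteq> Y \<times> UNIV" "v \<in> words Y"
  shows "foldr push_letter u v \<in> words Y"
  using assms set_foldr_push[of u v] by (auto simp: words_iff freely_reduced_foldr_push)

lemma words_mono: "S \<subseteq> Y \<Longrightarrow> words S \<subseteq> words Y"
  by (fastforce simp: words_iff)

context group
begin

lemma inv_mult_cancel:
  "x \<in> carrier G \<Longrightarrow> y \<in> carrier G \<Longrightarrow> inv x \<otimes> (x \<otimes> y) = y"
  by (simp add: m_assoc[symmetric])

lemma eval_word_Nil [simp]: "eval_word G f [] = \<one>"
  by (simp add: eval_word_def)

lemma eval_word_Cons [simp]: "eval_word G f (a # w) = letter_value G f a \<otimes> eval_word G f w"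
  by (simp add: eval_word_def)

lemma letter_value_in_subgroup:
  assumes "subgroup A G" "f ` Y \<subseteq> A" "fst a \<in> Y"
  shows "letter_value G f a \<in> A"
  using assms by (auto simp: letter_value_def subgroup.m_inv_closed)

lemma eval_word_in_subgroup:
  assumes "subgroup A G" "f ` Y \<subseteq> A" "set w \<subseteq> Y \<times> UNIV"
  shows "eval_word G f w \<in> A"
  using assms(3)
proof (induction w)
  case Nil
  then show ?case using assms(1) by (simp add: subgroup.one_closed)
next
  case (Cons a w)
  then have "fst a \<in> Y" "eval_word G f w \<in> A" by auto
  then show ?case
    using letter_value_in_subgroup[OF assms(1,2)] by (simp add: subgroup.m_closed[OF assms(1)])
qed

lemma letter_value_closed:
  "f ` Y \<subseteq> carrier G \<Longrightarrow> fst a \<in> Y \<Longrightarrow> letter_value G f a \<in> carrier G"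
  by (rule letter_value_in_subgroup[OF subgroup_self])

lemma eval_word_closed:
  "f ` Y \<subseteq> carrier G \<Longrightarrow> set w \<subseteq> Y \<times> UNIV \<Longrightarrow> eval_word G f w \<in> carrier G"
  by (rule eval_word_in_subgroup[OF subgroup_self])

lemma letter_value_inv_letter:
  "f ` Y \<subseteq> carrier G \<Longrightarrow> fst a \<in> Y \<Longrightarrow>
    letter_value G f (inv_letter a) = inv (letter_value G f a)"
  by (auto simp: letter_value_def inv_letter_def)

lemma eval_word_append:
  assumes "f ` Y \<subseteq> carrier G" "set u \<subseteq> Y \<times> UNIV" "set v \<subseteq> Y \<times> UNIV"
  shows "eval_word G f (u @ v) = eval_word G f u \<otimes> eval_word G f v"
  using assms(2)
proof (induction u)
  case Nil
  then show ?case using eval_word_closed[OF assms(1,3)] by simp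
next
  case (Cons a u)
  then have "fst a \<in> Y" "set u \<subseteq> Y \<times> UNIV" by auto
  then show ?case
    using Cons.IH letter_value_closed[OF assms(1)] eval_word_closed[OF assms(1)] assms(3)
    by (simp add: m_assoc)
qed

lemma eval_word_push:
  assumes "f ` Y \<subseteq> carrier G" "fst a \<in> Y" "set w \<subseteq> Y \<times> UNIV"
  shows "eval_word G f (push_letter a w) = letter_value G f a \<otimes> eval_word G f w"
proof (cases w)
  case (Cons b v)
  have "set v \<subseteq> Y \<times> UNIV" using assms(3) Cons by auto
  then show ?thesis
    using Cons letter_value_inv_letter[OF assms(1,2)] letter_value_closed[OF assms(1,2)]
      eval_word_closed[OF assms(1)]
    by (auto simp: m_assoc[symmetric])
qed (use letter_value_closed[OF assms(1,2)] in simp)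

lemma eval_word_foldr_push:
  assumes "f ` Y \<subseteq> carrier G" "set u \<subseteq> Y \<times> UNIV" "set v \<subseteq> Y \<times> UNIV"
  shows "eval_word G f (foldr push_letter u v) = eval_word G f u \<otimes> eval_word G f v"
  using assms(2)
proof (induction u)
  case Nil
  then show ?case using eval_word_closed[OF assms(1,3)] by simp
next
  case (Cons a u)
  then have a: "fst a \<in> Y" "set u \<subseteq> Y \<times> UNIV" by auto
  then have "set (foldr push_letter u v) \<subseteq> Y \<times> UNIV"
    using set_foldr_push[of u v] assms(3) by auto
  then show ?case
    using a Cons.IH letter_value_closed[OF assms(1)] eval_word_closed[OF assms(1)] assms(3)
    by (simp add: eval_word_push[OF assms(1)] m_assoc)
qed

lemma group_hom_eval_word:
  assumes "f ` Y \<subseteq> carrier G"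
  shows "group_hom (free_group Y) G (eval_word G f)"
proof -
  have "eval_word G f \<in> hom (free_group Y) G"
    using eval_word_foldr_push[OF assms] eval_word_closed[OF assms]
    by (auto simp: hom_def words_iff mult_free_group)
  then show ?thesis
    by (simp add: group_hom_def group_hom_axioms_def group_free_group is_group)
qed

lemma subgroup_eval_word_image:
  "f ` Y \<subseteq> carrier G \<Longrightarrow> subgroup (eval_word G f ` words Y) G"
  by (rule group_hom.img_is_subgroup[OF group_hom_eval_word])

lemma eval_word_image_generators:
  assumes "f ` Y \<subseteq> carrier G"
  shows "f ` Y \<subseteq> eval_word G f ` words Y"
proof
  fix g assume "g \<in> f ` Y"
  then obtain y where y: "y \<in> Y" "g = f y" by auto
  then have "eval_word G f [(y, True)] = g" "[(y, True)] \<in> words Y"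
    using assms by (auto simp: letter_value_def words_iff)
  then show "g \<in> eval_word G f ` words Y" by force
qed

lemma free_basisI:
  assumes "f ` Y \<subseteq> carrier G" "eval_word G f ` words Y = A"
    and "\<And>w. w \<in> words Y \<Longrightarrow> eval_word G f w = \<one> \<Longrightarrow> w = []"
  shows "free_basis G f Y A"
proof -
  interpret h: group_hom "free_group Y" G "eval_word G f" by (rule group_hom_eval_word) fact
  have "inj_on (eval_word G f) (words Y)"
    by (rule h.trivial_ker_imp_inj)
      (use assms(3) in \<open>auto simp: kernel_def one_free_group words_iff\<close>)
  then show ?thesis using assms by (auto simp: free_basis_def bij_betw_def)
qed

lemma free_basis_image: "free_basis G f Y A \<Longrightarrow> A = eval_word G f ` words Y"
  by (simp add: free_basis_def bij_betw_def)

lemma free_basis_carrier: "free_basis G f Y A \<Longrightarrow> f ` Y \<subseteq> carrier G"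
  by (simp add: free_basis_def)

lemma free_basis_subgroup: "free_basis G f Y A \<Longrightarrow> subgroup A G"
  using subgroup_eval_word_image free_basis_image free_basis_carrier by metis

lemma free_basis_generators: "free_basis G f Y A \<Longrightarrow> f ` Y \<subseteq> A"
  using eval_word_image_generators free_basis_image free_basis_carrier by metis

lemma free_basis_inj: "free_basis G f Y A \<Longrightarrow> inj_on (eval_word G f) (words Y)"
  by (simp add: free_basis_def bij_betw_def)

lemma free_basis_trivial:
  assumes "free_basis G f Y A" "w \<in> words Y" "eval_word G f w = \<one>"
  shows "w = []"
  using inj_onD[OF free_basis_inj[OF assms(1)], of w "[]"] assms(2,3) by (simp add: words_iff)

lemma free_basis_subset:
  assumes "free_basis G f Y A" "S \<subseteq> Y"
  shows "free_basis G f S (eval_word G f ` words S)"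
  using assms words_mono[OF assms(2)] unfolding free_basis_def bij_betw_def
  by (auto intro: inj_on_subset)

text \<open>\<open>foldr push_letter u []\<close> is the free reduction of an arbitrary word
  \<open>u\<close>. Both reductions lie in \<open>words Y\<close> and have the same value
  there.\<close>

lemma free_basis_foldr_push_cong:
  assumes "free_basis G f Y A" "set u \<subseteq> Y \<times> UNIV" "set v \<subseteq> Y \<times> UNIV"
    and "eval_word G f u = eval_word G f v"
  shows "foldr push_letter u [] = foldr push_letter v []"
proof (rule inj_onD[OF free_basis_inj[OF assms(1)]])
  have "eval_word G f u \<in> carrier G" "eval_word G f v \<in> carrier G"
    using eval_word_closed[OF free_basis_carrier[OF assms(1)]] assms by auto
  then show "eval_word G f (foldr push_letter u []) = eval_word G f (foldr push_letter v [])"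
    using assms by (simp add: eval_word_foldr_push[OF free_basis_carrier[OF assms(1)]])
qed (use assms in \<open>auto intro!: foldr_push_in_words simp: words_iff[of "[]"]\<close>)

end

text \<open>Evaluating a word at the one-letter words is free reduction, which fixes reduced
  words.\<close>

lemma free_basis_free_group: "free_basis (free_group X) (\<lambda>x. [(x, True)]) X (words X)"
proof -
  interpret F: group "free_group X" by (rule group_free_group)
  have car: "(\<lambda>x. [(x, True)]) ` X \<subseteq> words X" by (auto simp: words_iff)
  have inv: "inv\<^bsub>free_group X\<^esub> [(x, True)] = [(x, False)]" if "x \<in> X" for x
    by (rule F.inv_equality)
      (use that in \<open>auto simp: words_iff mult_free_group one_free_group inv_letter_def\<close>)
  have ev: "eval_word (free_group X) (\<lambda>x. [(x, True)]) w = foldr push_letter w []"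
    if "set w \<subseteq> X \<times> UNIV" for w
    using that
  proof (induction w)
    case (Cons a w)
    then have "letter_value (free_group X) (\<lambda>x. [(x, True)]) a = [a]"
      by (cases a) (auto simp: letter_value_def inv)
    then show ?case using Cons by (simp add: mult_free_group)
  qed (simp add: one_free_group)
  then have "eval_word (free_group X) (\<lambda>x. [(x, True)]) w = w" if "w \<in> words X" for w
    using that by (auto simp: words_iff foldr_push_reduced)
  then show ?thesis by (intro F.free_basisI) (use car in \<open>auto simp: one_free_group\<close>)
qed

section \<open>Schreier bases\<close>

text \<open>A letter-by-letter translation with a state: \<open>d\<close> is the transition and
  \<open>s\<close> the emitted word. The emitted words are multiplied in the free group, so the
  output is always reduced.\<close>

fun transduce :: "('s \<Rightarrow> 'a \<Rightarrow> 's) \<Rightarrow> ('s \<Rightarrow> 'a \<Rightarrow> 'b word) \<Rightarrow> 's \<Rightarrow> 'a list \<Rightarrow> 'b word" where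
  "transduce d s t [] = []"
| "transduce d s t (a # w) = foldr push_letter (s t a) (transduce d s (d t a) w)"

lemma freely_reduced_transduce: "freely_reduced (transduce d s t w)"
  by (induction w arbitrary: t) (auto simp: freely_reduced_foldr_push)

text \<open>Prefix-closed sets of reduced words with at most one word in each right coset of
  \<open>H\<close>: subtrees, rooted at \<open>H\<close>, of the coset graph. Cosets may be missed,
  so that such a set can be extended in stages over growing alphabets.\<close>

definition (in group) partial_transversal :: "('y \<Rightarrow> 'a) \<Rightarrow> 'y set \<Rightarrow> 'a set \<Rightarrow> 'y word set \<Rightarrow> bool"
  where "partial_transversal f Z H T \<longleftrightarrow>
    T \<subseteq> words Z \<and> [] \<in> T \<and> (\<forall>u a. u @ [a] \<in> T \<longrightarrow> u \<in> T)
    \<and> inj_on (\<lambda>t. H #> eval_word G f t) T"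

text \<open>Take a maximal extension by Zorn's lemma. Were a coset missed, a missed one adjacent to
  a represented one could be added as a new leaf.\<close>

lemma (in group) partial_transversal_extension:
  assumes f: "f ` Z \<subseteq> carrier G" and H: "subgroup H G" and T0: "partial_transversal f Z H T0"
  shows "\<exists>T. T0 \<subseteq> T \<and> partial_transversal f Z H T
    \<and> (\<forall>w. set w \<subseteq> Z \<times> UNIV \<longrightarrow> (\<exists>t\<in>T. H #> eval_word G f t = H #> eval_word G f w))"
proof -
  let ?c = "\<lambda>t. H #> eval_word G f t"
  define P where "P = {T. T0 \<subseteq> T \<and> partial_transversal f Z H T}"
  have P_iff: "T \<in> P \<longleftrightarrow> T0 \<subseteq> T \<and> T \<subseteq> words Z \<and> [] \<in> T
    \<and> (\<forall>u a. u @ [a] \<in> T \<longrightarrow> u \<in> T) \<and> inj_on ?c T" for T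
    unfolding P_def partial_transversal_def by blast
  have "\<exists>M\<in>P. \<forall>T\<in>P. M \<subseteq> T \<longrightarrow> T = M"
  proof (rule subset_Zorn_nonempty)
    show "P \<noteq> {}" using T0 unfolding P_def by blast
  next
    fix C assume C: "C \<noteq> {}" "subset.chain P C"
    then have CP: "\<And>T. T \<in> C \<Longrightarrow> T \<in> P" by (auto simp: subset.chain_def)
    have "inj_on ?c (\<Union>C)"
    proof (rule inj_onI)
      fix s t assume st: "s \<in> \<Union>C" "t \<in> \<Union>C" "?c s = ?c t"
      then obtain A B where AB: "A \<in> C" "s \<in> A" "B \<in> C" "t \<in> B" by auto
      then have "A \<subseteq> B \<or> B \<subseteq> A" using C(2) by (auto simp: subset_chain_def)
      then obtain D where "D \<in> C" "s \<in> D" "t \<in> D" using AB by auto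
      moreover have "inj_on ?c D" using CP[OF \<open>D \<in> C\<close>] unfolding P_iff by blast
      ultimately show "s = t" using st(3) by (auto dest: inj_onD)
    qed
    moreover have "T0 \<subseteq> \<Union>C" "[] \<in> \<Union>C" using C(1) CP unfolding P_iff by blast+
    moreover have "\<Union>C \<subseteq> words Z" using CP unfolding P_iff by blast
    moreover have "\<forall>u a. u @ [a] \<in> \<Union>C \<longrightarrow> u \<in> \<Union>C" using CP unfolding P_iff by blast
    ultimately show "\<Union>C \<in> P" unfolding P_iff by blast
  qed
  then obtain M where M: "M \<in> P" "\<And>T. T \<in> P \<Longrightarrow> M \<subseteq> T \<Longrightarrow> T = M" by blast
  have MT: "[] \<in> M" "M \<subseteq> words Z" "\<And>u a. u @ [a] \<in> M \<Longrightarrow> u \<in> M" "inj_on ?c M"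
    using M(1) unfolding P_iff by blast+
  have "\<exists>t\<in>M. ?c t = ?c w" if "set w \<subseteq> Z \<times> UNIV" for w
    using that
  proof (induction w rule: rev_induct)
    case Nil
    then show ?case using MT(1) by (intro bexI[of _ "[]"]) simp_all
  next
    case (snoc a w)
    then have a: "fst a \<in> Z" and w: "set w \<subseteq> Z \<times> UNIV" by auto
    with snoc obtain t where t: "t \<in> M" "?c t = ?c w" by auto
    have tZ: "set t \<subseteq> Z \<times> UNIV" "freely_reduced t"
      using subsetD[OF MT(2) t(1)] by (simp_all add: words_iff)
    have aZ: "set [a] \<subseteq> Z \<times> UNIV" using snoc.prems by simp
    note cl = eval_word_closed[OF f] letter_value_closed[OF f a]
    have Hc: "H \<subseteq> carrier G" using H by (rule subgroup.subset)
    have eq: "?c (t @ [a]) = ?c (w @ [a])"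
      using t(2) cl tZ w aZ Hc
      by (simp add: eval_word_append[OF f] coset_mult_assoc[symmetric])
    show ?case
    proof (cases "freely_reduced (t @ [a])")
      \<comment> \<open>The leaf \<open>t @ [a]\<close> keeps the set prefix-closed, so maximality
        forbids that its coset is missed.\<close>
      case True
      show ?thesis
      proof (rule ccontr)
        assume no: "\<not> ?thesis"
        have "t @ [a] \<in> words Z" using True tZ aZ by (simp add: words_iff)
        moreover have "?c (t @ [a]) \<notin> ?c ` M" using no eq by auto
        then have "inj_on ?c (insert (t @ [a]) M)" using MT(4) by (auto intro: inj_on_insert[THEN iffD2])
        moreover have "u \<in> insert (t @ [a]) M" if "u @ [b] \<in> insert (t @ [a]) M" for u b
          using that t(1) MT(3) by blast
        moreover have "T0 \<subseteq> M" using M(1) unfolding P_iff by blast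
        ultimately have "insert (t @ [a]) M \<in> P" using MT(1,2) unfolding P_iff by blast
        then have "t @ [a] \<in> M" using M(2)[of "insert (t @ [a]) M"] by auto
        with no eq show False by auto
      qed
    next
      \<comment> \<open>Here \<open>t\<close> ends in the inverse of \<open>a\<close>: the edge
        leads back to the parent of \<open>t\<close>, which is present by prefix closure.\<close>
      case False
      then have "t \<noteq> []" "a = inv_letter (last t)"
        using tZ(2) by (auto simp: freely_reduced_def successively_append_iff)
      then obtain u where u: "t = u @ [inv_letter a]"
        by (metis append_butlast_last_id inv_letter_inv_letter)
      then have uZ: "set u \<subseteq> Z \<times> UNIV" "u \<in> M" using tZ t(1) MT(3) by auto
      have "set [inv_letter a] \<subseteq> Z \<times> UNIV" using a by (cases a) (auto simp: inv_letter_def)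
      then have "eval_word G f (t @ [a]) = eval_word G f u"
        using u uZ tZ aZ cl
        by (simp add: eval_word_append[OF f] letter_value_inv_letter[OF f a] m_assoc)
      then show ?thesis using eq uZ by metis
    qed
  qed
  moreover have "T0 \<subseteq> M" "partial_transversal f Z H M"
    using M(1) unfolding P_def by blast+
  ultimately show ?thesis by blast
qed

section \<open>Reidemeister-Schreier rewriting along a Schreier transversal\<close>

locale Schreier_transversal = group G for G (structure) +
  fixes f :: "'y \<Rightarrow> 'a" and Y :: "'y set" and H :: "'a set" and T :: "'y word set"
  assumes basis: "free_basis G f Y (carrier G)"
    and subgroup_H: "subgroup H G"
    and partial: "partial_transversal f Y H T"
    and cover_T: "set w \<subseteq> Y \<times> UNIV \<Longrightarrow> \<exists>t\<in>T. H #> eval_word G f t = H #> eval_word G f w"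
begin

abbreviation ev :: "'y word \<Rightarrow> 'a" where "ev \<equiv> eval_word G f"

abbreviation lv :: "'y \<times> bool \<Rightarrow> 'a" where "lv \<equiv> letter_value G f"

definition rep :: "'a \<Rightarrow> 'y word"
  where "rep g = (SOME t. t \<in> T \<and> H #> ev t = H #> g)"

text \<open>The action of the letters on the right cosets of \<open>H\<close>, with cosets replaced
  by their representatives: the edges of the coset graph.\<close>

definition step :: "'y word \<Rightarrow> 'y \<times> bool \<Rightarrow> 'y word"
  where "step t a = rep (ev t \<otimes> lv a)"

definition schreier_elem :: "'y word \<Rightarrow> 'y \<times> bool \<Rightarrow> 'a"
  where "schreier_elem t a = ev t \<otimes> lv a \<otimes> inv ev (step t a)"

text \<open>Reading a letter \<open>a\<close> in state \<open>t\<close> emits the Schreier generator of the edge from \<open>t\<close>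
  (Reidemeister--Schreier rewriting); edges of the spanning tree \<open>T\<close> emit nothing.  A negative
  letter traverses an edge backwards, so that the generator is the inverse of
  \<open>schreier_elem t a\<close>.\<close>

definition out :: "'y word \<Rightarrow> 'y \<times> bool \<Rightarrow> 'a word"
  where "out t a = (let g = schreier_elem t a in
    if g = \<one> then [] else [(if snd a then g else inv g, snd a)])"

abbreviation rewrite_word :: "'y word \<Rightarrow> 'y word \<Rightarrow> 'a word"
  where "rewrite_word \<equiv> transduce step out"

text \<open>Positive letters suffice, since the reverse of an edge gives the inverse element. The
  parameters single out a part of the graph. As this is a set of group elements, it need not be
  known that different edges give different generators.\<close>

definition schreier_gens :: "'y word set \<Rightarrow> 'y set \<Rightarrow> 'a set"
  where "schreier_gens T1 Z = {schreier_elem t (y, True) |t y. t \<in> T1 \<and> y \<in> Z} - {\<one>}"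

lemma T_words: "T \<subseteq> words Y"
  and Nil_T: "[] \<in> T"
  and prefix_T: "u @ [a] \<in> T \<Longrightarrow> u \<in> T"
  and inj_T: "inj_on (\<lambda>t. H #> ev t) T"
  using partial unfolding partial_transversal_def by blast+

lemma f_closed: "f ` Y \<subseteq> carrier G"
  using basis by (rule free_basis_carrier)

lemmas ev_closed [simp, intro] = eval_word_closed[OF f_closed]

lemmas lv_closed [simp, intro] = letter_value_closed[OF f_closed]

lemma T_letters: "t \<in> T \<Longrightarrow> set t \<subseteq> Y \<times> UNIV"
  using T_words by (fastforce simp: words_iff)

lemma ev_T_closed [simp, intro]: "t \<in> T \<Longrightarrow> ev t \<in> carrier G"
  using T_letters by auto

lemma obtain_word:
  assumes "g \<in> carrier G"
  obtains w where "set w \<subseteq> Y \<times> UNIV" "ev w = g"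
  using assms free_basis_image[OF basis] by (auto simp: words_iff)

lemma rep:
  assumes "g \<in> carrier G"
  shows "rep g \<in> T" "H #> ev (rep g) = H #> g"
proof -
  obtain w where "set w \<subseteq> Y \<times> UNIV" "ev w = g" using obtain_word[OF assms] .
  then have "\<exists>t. t \<in> T \<and> H #> ev t = H #> g" using cover_T by blast
  then show "rep g \<in> T" "H #> ev (rep g) = H #> g"
    unfolding rep_def by (metis (mono_tags, lifting) someI_ex)+
qed

lemma rep_eqI:
  assumes "t \<in> T" "g \<in> carrier G" "H #> ev t = H #> g"
  shows "rep g = t"
  using inj_onD[OF inj_T] rep[OF assms(2)] assms by auto

lemma rep_T: "t \<in> T \<Longrightarrow> rep (ev t) = t"
  by (rule rep_eqI) auto

lemma rep_H:
  assumes "g \<in> H" shows "rep g = []"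
proof (rule rep_eqI)
  show "g \<in> carrier G" using assms subgroup.subset[OF subgroup_H] by auto
  show "H #> ev [] = H #> g"
    using assms subgroup_H subgroup.subset[OF subgroup_H]
    by (simp add: subgroup.rcos_const[OF _ is_group] coset_mult_one)
qed (rule Nil_T)

lemma rep_mult_left:
  assumes "g \<in> carrier G" "h \<in> carrier G"
  shows "rep (ev (rep g) \<otimes> h) = rep (g \<otimes> h)"
proof -
  have Hc: "H \<subseteq> carrier G" using subgroup_H by (rule subgroup.subset)
  note r = rep[OF assms(1)]
  have "H #> (ev (rep g) \<otimes> h) = H #> (g \<otimes> h)"
    using r assms Hc by (simp add: coset_mult_assoc[symmetric])
  then show ?thesis using rep[of "g \<otimes> h"] r assms by (intro rep_eqI) auto
qed

lemma step_T: "t \<in> T \<Longrightarrow> fst a \<in> Y \<Longrightarrow> step t a \<in> T"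
  unfolding step_def by (rule rep(1)) auto

lemma step_inv_letter:
  assumes "t \<in> T" "fst a \<in> Y"
  shows "step (step t a) (inv_letter a) = t"
proof -
  have "step (step t a) (inv_letter a) = rep (ev t \<otimes> lv a \<otimes> inv lv a)"
    unfolding step_def using assms
    by (subst rep_mult_left) (auto simp: letter_value_inv_letter[OF f_closed])
  also have "\<dots> = t" using assms by (simp add: m_assoc rep_T)
  finally show ?thesis .
qed

lemma schreier_elem_closed [simp, intro]:
  "t \<in> T \<Longrightarrow> fst a \<in> Y \<Longrightarrow> schreier_elem t a \<in> carrier G"
  unfolding schreier_elem_def using step_T by auto

lemma schreier_elem_H:
  assumes "t \<in> T" "fst a \<in> Y" shows "schreier_elem t a \<in> H"
proof -
  let ?g = "ev t \<otimes> lv a"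
  have g: "?g \<in> carrier G" using assms by auto
  have "?g \<in> H #> ev (rep ?g)"
    using rep(2)[OF g] rcos_self[OF g subgroup_H] by simp
  then obtain h where h: "h \<in> H" "?g = h \<otimes> ev (rep ?g)" by (auto simp: r_coset_def)
  moreover have "h \<in> carrier G" using h(1) subgroup.subset[OF subgroup_H] by auto
  ultimately show ?thesis
    using ev_T_closed[OF rep(1)[OF g]] unfolding schreier_elem_def step_def
    by (metis m_assoc r_inv r_one inv_closed)
qed

lemma schreier_elem_inv_letter:
  assumes "t \<in> T" "fst a \<in> Y"
  shows "schreier_elem (step t a) (inv_letter a) = inv (schreier_elem t a)"
  using assms step_T[OF assms]
  by (simp add: schreier_elem_def step_inv_letter letter_value_inv_letter[OF f_closed]
      inv_mult_group m_assoc)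

lemma out_inv_letter:
  assumes "t \<in> T" "fst a \<in> Y"
  shows "out (step t a) (inv_letter a) = map inv_letter (out t a)"
  using assms
  by (auto simp: out_def Let_def schreier_elem_inv_letter)
    (auto simp: inv_letter_def)

lemma eval_out:
  assumes "t \<in> T" "fst a \<in> Y"
  shows "eval_word G (\<lambda>x. x) (out t a) = schreier_elem t a"
  using assms by (auto simp: out_def Let_def letter_value_def)

lemma foldr_push_out_cancel:
  assumes "t \<in> T" "fst a \<in> Y" "freely_reduced w"
  shows "foldr push_letter (out t a) (foldr push_letter (out (step t a) (inv_letter a)) w) = w"
  unfolding out_inv_letter[OF assms(1,2)]
  using assms(3) by (auto simp: out_def Let_def push_letter_cancel)

text \<open>A cancelling pair of letters walks along an edge and back, and the two outputs are
  mutually inverse.\<close>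

lemma rewrite_word_push:
  assumes "t \<in> T" "fst a \<in> Y" "set w \<subseteq> Y \<times> UNIV"
  shows "rewrite_word t (push_letter a w) = rewrite_word t (a # w)"
proof (cases w)
  case (Cons b v)
  then show ?thesis
    using assms by (auto simp: step_inv_letter foldr_push_out_cancel freely_reduced_transduce)
qed simp

lemma rewrite_word_foldr_push:
  assumes "t \<in> T" "set u \<subseteq> Y \<times> UNIV" "set v \<subseteq> Y \<times> UNIV"
  shows "rewrite_word t (foldr push_letter u v) = rewrite_word t (u @ v)"
  using assms(1,2)
proof (induction u arbitrary: t)
  case (Cons a u)
  then have a: "fst a \<in> Y" "set u \<subseteq> Y \<times> UNIV" by auto
  have "set (foldr push_letter u v) \<subseteq> Y \<times> UNIV"
    using set_foldr_push[of u v] a assms(3) by auto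
  then show ?case using Cons.IH[OF step_T] Cons.prems a by (simp add: rewrite_word_push)
qed simp

text \<open>Rewriting is insensitive to free reduction, and words of equal value have equal
  reductions because \<open>f\<close> is a basis. Hence rewriting depends only on the group
  element.\<close>

lemma rewrite_word_cong:
  assumes "t \<in> T" "set u \<subseteq> Y \<times> UNIV" "set v \<subseteq> Y \<times> UNIV" "ev u = ev v"
  shows "rewrite_word t u = rewrite_word t v"
  using rewrite_word_foldr_push[OF assms(1,2), of "[]"]
    rewrite_word_foldr_push[OF assms(1,3), of "[]"]
    free_basis_foldr_push_cong[OF basis assms(2,3,4)] by simp

lemma rewrite_word_append:
  assumes "t \<in> T" "set u \<subseteq> Y \<times> UNIV" "set v \<subseteq> Y \<times> UNIV"
  shows "rewrite_word t (u @ v) =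
    foldr push_letter (rewrite_word t u) (rewrite_word (rep (ev t \<otimes> ev u)) v)"
  using assms(1,2)
proof (induction u arbitrary: t)
  case Nil
  then show ?case by (simp add: rep_T)
next
  case (Cons a u)
  then have a: "fst a \<in> Y" "set u \<subseteq> Y \<times> UNIV" by auto
  have "rep (ev (step t a) \<otimes> ev u) = rep (ev t \<otimes> (lv a \<otimes> ev u))"
    unfolding step_def using Cons.prems a by (subst rep_mult_left) (auto simp: m_assoc)
  then show ?case
    using Cons.IH[OF step_T] Cons.prems a
    by (simp add: foldr_push_assoc freely_reduced_transduce)
qed

text \<open>The emitted Schreier generators form a telescoping product along the walk. From state
  \<open>[]\<close> a word with value in \<open>H\<close> ends at \<open>[]\<close> again, so its
  rewriting has the same value as the word.\<close>

lemma eval_rewrite_word: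
  assumes "t \<in> T" "set w \<subseteq> Y \<times> UNIV"
  shows "set (rewrite_word t w) \<subseteq> carrier G \<times> UNIV"
    and "eval_word G (\<lambda>x. x) (rewrite_word t w) = ev t \<otimes> ev w \<otimes> inv ev (rep (ev t \<otimes> ev w))"
proof -
  have "set (rewrite_word t w) \<subseteq> carrier G \<times> UNIV
    \<and> eval_word G (\<lambda>x. x) (rewrite_word t w) = ev t \<otimes> ev w \<otimes> inv ev (rep (ev t \<otimes> ev w))"
    using assms
  proof (induction w arbitrary: t)
    case Nil
    then show ?case by (simp add: rep_T)
  next
    case (Cons a w)
    then have a: "fst a \<in> Y" "set w \<subseteq> Y \<times> UNIV" by auto
    note st = step_T[OF Cons.prems(1) a(1)]
    let ?s = "step t a"
    note IH = Cons.IH[OF st a(2)]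
    have o: "set (out t a) \<subseteq> carrier G \<times> UNIV"
      using Cons.prems a by (auto simp: out_def Let_def)
    have self: "(\<lambda>x. x) ` carrier G \<subseteq> carrier G" by simp
    have r: "rep (ev ?s \<otimes> ev w) = rep (ev t \<otimes> (lv a \<otimes> ev w))"
      unfolding step_def using Cons.prems a by (subst rep_mult_left) (auto simp: m_assoc)
    have rc: "ev (rep (ev t \<otimes> (lv a \<otimes> ev w))) \<in> carrier G"
      using Cons.prems a by (intro ev_T_closed rep(1)) auto
    have "eval_word G (\<lambda>x. x) (rewrite_word t (a # w))
      = eval_word G (\<lambda>x. x) (out t a) \<otimes> eval_word G (\<lambda>x. x) (rewrite_word ?s w)"
      using eval_word_foldr_push[OF self o] IH by simp
    also have "\<dots> = schreier_elem t a \<otimes> (ev ?s \<otimes> ev w \<otimes> inv ev (rep (ev ?s \<otimes> ev w)))"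
      using IH eval_out[OF Cons.prems(1) a(1)] by presburger
    also have "\<dots> = ev t \<otimes> (lv a \<otimes> ev w) \<otimes> inv ev (rep (ev t \<otimes> (lv a \<otimes> ev w)))"
      unfolding r schreier_elem_def using Cons.prems a st rc
      by (simp add: m_assoc inv_mult_cancel)
    finally have "eval_word G (\<lambda>x. x) (rewrite_word t (a # w))
      = ev t \<otimes> ev (a # w) \<otimes> inv ev (rep (ev t \<otimes> ev (a # w)))" by simp
    moreover have "set (rewrite_word t (a # w)) \<subseteq> carrier G \<times> UNIV"
      using IH o set_foldr_push[of "out t a" "rewrite_word ?s w"] by auto
    ultimately show ?case by blast
  qed
  then show "set (rewrite_word t w) \<subseteq> carrier G \<times> UNIV"
    "eval_word G (\<lambda>x. x) (rewrite_word t w) = ev t \<otimes> ev w \<otimes> inv ev (rep (ev t \<otimes> ev w))" by auto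
qed

text \<open>By prefix closure the walk stays inside the tree, whose edges have trivial Schreier
  elements.\<close>

lemma rewrite_word_transversal: "t \<in> T \<Longrightarrow> rewrite_word [] t = []"
proof (induction t rule: rev_induct)
  case (snoc a u)
  then have u: "u \<in> T" "rewrite_word [] u = []" using prefix_T by auto
  have a: "fst a \<in> Y" "set u \<subseteq> Y \<times> UNIV" "set [a] \<subseteq> Y \<times> UNIV"
    using T_letters[OF snoc.prems] by auto
  have e: "ev (u @ [a]) = ev u \<otimes> lv a"
    using a by (simp add: eval_word_append[OF f_closed])
  then have "step u a = u @ [a]" using rep_T[OF snoc.prems] by (simp add: step_def)
  then have "schreier_elem u a = \<one>"
    using e snoc.prems a u by (simp add: schreier_elem_def)
  then have "out u a = []" by (simp add: out_def)
  then show ?case using u a Nil_T by (simp add: rewrite_word_append rep_T)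
qed simp

lemma rewrite_word_schreier_elem:
  assumes "t \<in> T" "fst a \<in> Y" "set w \<subseteq> Y \<times> UNIV" "ev w = schreier_elem t a"
  shows "rewrite_word [] w = out t a"
proof -
  let ?s = "step t a"
  note s = step_T[OF assms(1,2)] T_letters[OF step_T[OF assms(1,2)]]
  have aY: "set [a] \<subseteq> Y \<times> UNIV" using assms(2) by (cases a) auto
  have tl: "set t \<subseteq> Y \<times> UNIV" using T_letters assms by auto
  \<comment> \<open>Appending the representative \<open>?s\<close> allows both sides to be rewritten
    as walks. Reading \<open>w\<close> returns to \<open>[]\<close> since its value is in
    \<open>H\<close>, and then \<open>?s\<close> emits nothing; on the other side \<open>t\<close>
    emits nothing and \<open>a\<close> emits \<open>out t a\<close>.\<close>
  have "ev (w @ ?s) = ev (t @ [a])"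
    using assms s tl aY by (simp add: eval_word_append[OF f_closed] schreier_elem_def m_assoc)
  then have "rewrite_word [] (w @ ?s) = rewrite_word [] (t @ [a])"
    using assms s tl aY by (intro rewrite_word_cong Nil_T) auto
  moreover have "rewrite_word [] (w @ ?s) = rewrite_word [] w"
    using assms s schreier_elem_H[OF assms(1,2)]
    by (simp add: rewrite_word_append Nil_T rep_H rewrite_word_transversal
        foldr_push_reduced freely_reduced_transduce)
  moreover have "rewrite_word [] (t @ [a]) = out t a"
    using assms tl aY
    by (simp add: rewrite_word_append Nil_T rep_T rewrite_word_transversal)
      (simp add: out_def Let_def)
  ultimately show ?thesis by simp
qed

lemma schreier_gens_H: "schreier_gens T Y \<subseteq> H"
  using schreier_elem_H by (auto simp: schreier_gens_def)

text \<open>A letter of either sign is the output of a single edge: a negative one comes from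
  walking the edge backwards from its endpoint.\<close>

lemma schreier_letter:
  assumes "fst c \<in> schreier_gens T Y"
  obtains t a where "t \<in> T" "fst a \<in> Y" "letter_value G (\<lambda>x. x) c = schreier_elem t a" "out t a = [c]"
proof -
  obtain t y where ty: "t \<in> T" "y \<in> Y" "fst c = schreier_elem t (y, True)" "fst c \<noteq> \<one>"
    using assms by (auto simp: schreier_gens_def)
  then have o: "out t (y, True) = [(fst c, True)]" by (simp add: out_def)
  show ?thesis
  proof (cases "snd c")
    case True
    then show ?thesis using that[of t "(y, True)"] ty o
      by (cases c) (auto simp: letter_value_def)
  next
    case False
    then show ?thesis
      using that[of "step t (y, True)" "inv_letter (y, True)"] ty o step_T[of t "(y, True)"]
        schreier_elem_inv_letter[of t "(y, True)"] out_inv_letter[of t "(y, True)"]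
      by (cases c) (auto simp: letter_value_def inv_letter_def)
  qed
qed

text \<open>Rewriting inverts evaluation of words in the Schreier generators, which are therefore free.\<close>

lemma rewrite_word_eval:
  assumes "set z \<subseteq> schreier_gens T Y \<times> UNIV" "set w \<subseteq> Y \<times> UNIV" "ev w = eval_word G (\<lambda>x. x) z"
  shows "rewrite_word [] w = foldr push_letter z []"
  using assms
proof (induction z arbitrary: w)
  case Nil
  then show ?case using rewrite_word_cong[OF Nil_T, of w "[]"] by simp
next
  case (Cons c z)
  then have z: "set z \<subseteq> schreier_gens T Y \<times> UNIV" and c: "fst c \<in> schreier_gens T Y" by auto
  have H: "(\<lambda>x. x) ` schreier_gens T Y \<subseteq> H" using schreier_gens_H by simp
  have Hc: "H \<subseteq> carrier G" using subgroup_H by (rule subgroup.subset)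
  obtain t a where ta: "t \<in> T" "fst a \<in> Y" "letter_value G (\<lambda>x. x) c = schreier_elem t a" "out t a = [c]"
    using schreier_letter[OF c] .
  obtain u where u: "set u \<subseteq> Y \<times> UNIV" "ev u = schreier_elem t a"
    using obtain_word[OF schreier_elem_closed[OF ta(1,2)]] .
  obtain v where v: "set v \<subseteq> Y \<times> UNIV" "ev v = eval_word G (\<lambda>x. x) z"
    using obtain_word[OF subsetD[OF Hc eval_word_in_subgroup[OF subgroup_H H z]]] .
  have "rewrite_word [] w = rewrite_word [] (u @ v)"
    using Cons.prems u v ta by (intro rewrite_word_cong Nil_T) (auto simp: eval_word_append[OF f_closed])
  also have "\<dots> = foldr push_letter [c] (foldr push_letter z [])"
    using u v ta Cons.IH[OF z v] rewrite_word_schreier_elem[OF ta(1,2) u] schreier_elem_H[OF ta(1,2)]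
    by (simp add: rewrite_word_append Nil_T rep_H)
  finally show ?case by simp
qed

text \<open>A walk with letters of \<open>Z\<close> that starts in \<open>T1\<close> never leaves
  \<open>T1\<close>, so it meets only edges of that part of the graph. Used for the whole graph and
  for the part over a subset of the basis.\<close>

lemma rewrite_word_letters:
  assumes T1: "T1 \<subseteq> T" "Z \<subseteq> Y" "\<And>t a. t \<in> T1 \<Longrightarrow> fst a \<in> Z \<Longrightarrow> step t a \<in> T1"
    and "t \<in> T1" "set w \<subseteq> Z \<times> UNIV"
  shows "set (rewrite_word t w) \<subseteq> schreier_gens T1 Z \<times> UNIV"
  using assms(4,5)
proof (induction w arbitrary: t)
  case (Cons a w)
  then have a: "fst a \<in> Z" "set w \<subseteq> Z \<times> UNIV" by auto
  have t: "t \<in> T" "fst a \<in> Y" using a Cons.prems T1 by auto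
  have "set (out t a) \<subseteq> schreier_gens T1 Z \<times> UNIV"
  proof (cases "snd a")
    case True
    then have "a = (fst a, True)" by (cases a) auto
    then show ?thesis using a Cons.prems
      by (auto simp: out_def Let_def schreier_gens_def)
  next
    \<comment> \<open>A negative letter emits the inverse of the positive edge that starts at
      \<open>step t a\<close>; that edge belongs to the part because \<open>T1\<close> is closed
      under \<open>step\<close>.\<close>
    case False
    then have "inv_letter a = (fst a, True)" by (simp add: inv_letter_def)
    then have "inv (schreier_elem t a) = schreier_elem (step t a) (fst a, True)"
      using schreier_elem_inv_letter[OF t] by simp
    moreover have "inv (schreier_elem t a) \<noteq> \<one>" if "schreier_elem t a \<noteq> \<one>"
      using that t by simp
    moreover have "step t a \<in> T1" using a Cons.prems T1(3) by auto
    ultimately show ?thesis using a False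
      unfolding out_def Let_def schreier_gens_def by auto
  qed
  moreover have "set (rewrite_word (step t a) w) \<subseteq> schreier_gens T1 Z \<times> UNIV"
    using Cons.IH[OF T1(3)] Cons.prems a by auto
  ultimately show ?case
    using set_foldr_push[of "out t a" "rewrite_word (step t a) w"] by auto
qed simp

lemma free_basis_schreier_gens: "free_basis G (\<lambda>x. x) (schreier_gens T Y) H"
proof (rule free_basisI)
  have H: "(\<lambda>x. x) ` schreier_gens T Y \<subseteq> H" using schreier_gens_H by simp
  have Hc: "H \<subseteq> carrier G" using subgroup_H by (rule subgroup.subset)
  show "(\<lambda>x. x) ` schreier_gens T Y \<subseteq> carrier G" using H Hc by auto
  show "eval_word G (\<lambda>x. x) ` words (schreier_gens T Y) = H"
  proof (rule equalityI; rule subsetI)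
    fix g assume "g \<in> eval_word G (\<lambda>x. x) ` words (schreier_gens T Y)"
    then show "g \<in> H" using eval_word_in_subgroup[OF subgroup_H H] by (auto simp: words_iff)
  next
    fix g assume g: "g \<in> H"
    then obtain w where w: "set w \<subseteq> Y \<times> UNIV" "ev w = g" using obtain_word Hc by blast
    have "rewrite_word [] w \<in> words (schreier_gens T Y)"
      using rewrite_word_letters[OF _ _ step_T Nil_T w(1)]
      by (simp add: words_iff freely_reduced_transduce)
    moreover have "eval_word G (\<lambda>x. x) (rewrite_word [] w) = g"
      using eval_rewrite_word[OF Nil_T w(1)] w g Hc by (auto simp: rep_H)
    ultimately show "g \<in> eval_word G (\<lambda>x. x) ` words (schreier_gens T Y)" by force
  qed
next
  fix z assume z: "z \<in> words (schreier_gens T Y)" "eval_word G (\<lambda>x. x) z = \<one>"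
  \<comment> \<open>The empty word has the same value as \<open>z\<close>, so its empty rewriting is
    the reduction of \<open>z\<close>.\<close>
  then have "rewrite_word [] [] = foldr push_letter z []"
    by (intro rewrite_word_eval) (auto simp: words_iff)
  then show "z = []" using z by (simp add: words_iff foldr_push_reduced)
qed

text \<open>By \<open>cover\<close>, the representatives written in \<open>S\<close> already serve
  every coset reached from \<open>H\<close> by letters of \<open>S\<close>. Rewriting an element of
  \<open>H\<close> that is a word in \<open>S\<close> therefore uses only edges between them;
  conversely the generators of these edges are words in \<open>S\<close>.\<close>

lemma eval_schreier_gens_subset:
  assumes S: "S \<subseteq> Y"
    and cover: "\<And>w. set w \<subseteq> S \<times> UNIV \<Longrightarrow> \<exists>t\<in>T \<inter> words S. H #> ev t = H #> ev w"
  shows "eval_word G (\<lambda>x. x) ` words (schreier_gens (T \<inter> words S) S) = H \<inter> ev ` words S"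
proof (rule equalityI; rule subsetI)
  let ?T = "T \<inter> words S"
  have fS: "f ` S \<subseteq> carrier G" using f_closed S by auto
  \<comment> \<open>The coset of \<open>t @ [a]\<close> has a representative written in
    \<open>S\<close>, and representatives are unique.\<close>
  have stepS: "step t a \<in> ?T" if ta: "t \<in> ?T" "fst a \<in> S" for t a
  proof -
    have l: "set t \<subseteq> S \<times> UNIV" "set [a] \<subseteq> S \<times> UNIV"
      using ta by (cases a; auto simp: words_iff)+
    then obtain s where s: "s \<in> ?T" "H #> ev s = H #> ev (t @ [a])"
      using cover[of "t @ [a]"] by auto
    have "ev (t @ [a]) = ev t \<otimes> lv a"
      using l eval_word_append[OF fS l] S ta by auto
    then have "step t a = s"
      unfolding step_def using s ta S by (intro rep_eqI) auto
    then show ?thesis using s by simp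
  qed
  show "g \<in> H \<inter> ev ` words S"
    if "g \<in> eval_word G (\<lambda>x. x) ` words (schreier_gens ?T S)" for g
  proof
    from that obtain z where z: "z \<in> words (schreier_gens ?T S)" "g = eval_word G (\<lambda>x. x) z" by blast
    then have z_letters: "set z \<subseteq> schreier_gens ?T S \<times> UNIV" by (simp add: words_iff)
    have sub: "subgroup (ev ` words S) G" by (rule subgroup_eval_word_image[OF fS])
    have "schreier_elem t (y, True) \<in> ev ` words S" if ty: "t \<in> ?T" "y \<in> S" for t y
    proof -
      have "ev t \<in> ev ` words S" "ev (step t (y, True)) \<in> ev ` words S"
        using ty stepS[of t "(y, True)"] by auto
      moreover have "lv (y, True) \<in> ev ` words S"
        using eval_word_image_generators[OF fS] ty by (auto simp: letter_value_def)
      ultimately show ?thesis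
        unfolding schreier_elem_def
        by (intro subgroup.m_closed[OF sub] subgroup.m_inv_closed[OF sub])
    qed
    then have "(\<lambda>x. x) ` schreier_gens ?T S \<subseteq> ev ` words S" by (auto simp: schreier_gens_def)
    then show "g \<in> ev ` words S"
      using eval_word_in_subgroup[OF sub _ z_letters] z(2) by simp
    have "(\<lambda>x. x) ` schreier_gens ?T S \<subseteq> H"
      using schreier_gens_H S by (auto simp: schreier_gens_def)
    then show "g \<in> H"
      using eval_word_in_subgroup[OF subgroup_H _ z_letters] z(2) by simp
  qed
  show "g \<in> eval_word G (\<lambda>x. x) ` words (schreier_gens ?T S)" if g: "g \<in> H \<inter> ev ` words S" for g
  proof -
    from g obtain w where "w \<in> words S" "ev w = g" by blast
    then have w: "set w \<subseteq> S \<times> UNIV" "ev w = g" by (simp_all add: words_iff)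
    then have wY: "set w \<subseteq> Y \<times> UNIV" using S by auto
    have "[] \<in> ?T" using Nil_T by (simp add: words_iff)
    then have "rewrite_word [] w \<in> words (schreier_gens ?T S)"
      using rewrite_word_letters[OF _ S stepS _ w(1)]
      by (simp add: words_iff freely_reduced_transduce)
    moreover have "eval_word G (\<lambda>x. x) (rewrite_word [] w) = g"
      using eval_rewrite_word[OF Nil_T wY] w g subgroup.subset[OF subgroup_H] by (auto simp: rep_H)
    ultimately show ?thesis by force
  qed
qed

end

lemma (in group) relative_Schreier_basis:
  assumes basis: "free_basis G f Y (carrier G)" and H: "subgroup H G" and S: "S \<subseteq> Y"
  shows "\<exists>B C. C \<subseteq> B \<and> free_basis G (\<lambda>x. x) B H \<and> free_basis G (\<lambda>x. x) C (H \<inter> eval_word G f ` words S)"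
proof -
  let ?c = "\<lambda>t. H #> eval_word G f t"
  have f: "f ` Y \<subseteq> carrier G" "f ` S \<subseteq> carrier G" using free_basis_carrier[OF basis] S by auto
  \<comment> \<open>First a tree over the alphabet \<open>S\<close> alone, reaching all cosets that
    meet the subgroup spanned by \<open>S\<close>.\<close>
  have "partial_transversal f S H {[]}"
    by (auto simp: partial_transversal_def words_iff)
  then obtain T0 where T0: "partial_transversal f S H T0"
    and cover0: "\<forall>w. set w \<subseteq> S \<times> UNIV \<longrightarrow> (\<exists>t\<in>T0. ?c t = ?c w)"
    using partial_transversal_extension[OF f(2) H] by blast
  \<comment> \<open>The same tree is then enlarged over all of \<open>Y\<close>, which leaves the
    representatives found first in place.\<close>
  then have "partial_transversal f Y H T0"
    using words_mono[OF S] unfolding partial_transversal_def by blast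
  then obtain T where T: "T0 \<subseteq> T" "partial_transversal f Y H T"
    and cover: "\<forall>w. set w \<subseteq> Y \<times> UNIV \<longrightarrow> (\<exists>t\<in>T. ?c t = ?c w)"
    using partial_transversal_extension[OF f(1) H] by blast
  interpret Schreier_transversal G f Y H T
    by (intro Schreier_transversal.intro Schreier_transversal_axioms.intro)
      (use is_group basis H T cover in blast)+
  let ?B = "schreier_gens T Y" and ?C = "schreier_gens (T \<inter> words S) S"
  have sub: "?C \<subseteq> ?B" using S by (auto simp: schreier_gens_def)
  have "\<exists>t\<in>T \<inter> words S. ?c t = ?c w" if "set w \<subseteq> S \<times> UNIV" for w
    using cover0 that T0 T(1) unfolding partial_transversal_def by blast
  then have "eval_word G (\<lambda>x. x) ` words ?C = H \<inter> eval_word G f ` words S"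
    by (rule eval_schreier_gens_subset[OF S])
  then show ?thesis
    using sub free_basis_schreier_gens free_basis_subset[OF free_basis_schreier_gens sub] by metis
qed

section \<open>Free products and unions of bases\<close>

lemma alternating_words_Nil [simp]: "[] \<in> alternating_words G A B"
  by (simp add: alternating_words_def)

lemma alternating_words_Cons:
  "p # w \<in> alternating_words G A B \<longleftrightarrow>
    snd p \<in> (if fst p then A else B) \<and> snd p \<noteq> \<one>\<^bsub>G\<^esub> \<and> w \<in> alternating_words G A B
    \<and> (w \<noteq> [] \<longrightarrow> fst p \<noteq> fst (hd w))"
  by (cases p; cases w) (auto simp: alternating_words_def)

lemma alternating_words_append:
  "u @ v \<in> alternating_words G A B \<longleftrightarrow>
    u \<in> alternating_words G A B \<and> v \<in> alternating_words G A B
    \<and> (u \<noteq> [] \<and> v \<noteq> [] \<longrightarrow> fst (last u) \<noteq> fst (hd v))"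
  by (auto simp: alternating_words_def successively_append_iff)

lemma word_product_Nil [simp]: "word_product G [] = \<one>\<^bsub>G\<^esub>"
  by (simp add: word_product_def)

lemma word_product_Cons [simp]: "word_product G (p # w) = snd p \<otimes>\<^bsub>G\<^esub> word_product G w"
  by (simp add: word_product_def)

section \<open>Normal forms in internal free products\<close>

context group
begin

lemma word_product_in_subgroup:
  assumes "subgroup L G" "snd ` set w \<subseteq> L"
  shows "word_product G w \<in> L"
  using assms(2)
  by (induction w) (auto simp: subgroup.one_closed[OF assms(1)] subgroup.m_closed[OF assms(1)])

lemma word_product_closed: "snd ` set w \<subseteq> carrier G \<Longrightarrow> word_product G w \<in> carrier G"
  by (rule word_product_in_subgroup[OF subgroup_self])

lemma word_product_append:
  assumes "snd ` set u \<subseteq> carrier G" "snd ` set v \<subseteq> carrier G"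
  shows "word_product G (u @ v) = word_product G u \<otimes> word_product G v"
  using assms(1) by (induction u) (auto simp: word_product_closed assms(2) m_assoc)

lemma word_product_inverse:
  assumes "snd ` set w \<subseteq> carrier G"
  shows "word_product G (rev (map (apsnd (\<lambda>g. inv g)) w)) = inv (word_product G w)"
  using assms
proof (induction w)
  case (Cons p w)
  have "snd ` set (rev (map (apsnd (\<lambda>g. inv g)) w)) \<subseteq> carrier G"
    using Cons.prems by auto
  then show ?case
    using Cons by (simp add: word_product_append word_product_closed inv_mult_group)
qed simp

lemma alternating_words_syllables:
  assumes "w \<in> alternating_words G A B" "A \<subseteq> L" "B \<subseteq> L"
  shows "snd ` set w \<subseteq> L"
  using assms by (induction w) (auto simp: alternating_words_Cons split: if_splits)

lemma alternating_words_inverse: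
  assumes "subgroup A G" "subgroup B G" "w \<in> alternating_words G A B"
  shows "rev (map (apsnd (\<lambda>g. inv g)) w) \<in> alternating_words G A B"
  using assms(3)
proof (induction w)
  case (Cons p w)
  have "inv snd p \<in> (if fst p then A else B)" "inv snd p \<noteq> \<one>"
    using Cons.prems assms(1,2) subgroup.subset
    by (auto simp: alternating_words_Cons subgroup.m_inv_closed subgroup.mem_carrier
        inv_eq_1_iff split: if_splits)
  moreover have "fst (last (rev (map (apsnd (\<lambda>g. inv g)) w))) = fst (hd w)" if "w \<noteq> []"
    using that by (cases w) auto
  ultimately show ?case
    using Cons by (auto simp: alternating_words_append alternating_words_Cons)
qed simp

text \<open>Alternating words carry no multiplication here, so injectivity does not follow formally
  from triviality of the kernel. The formal inverse of \<open>v\<close> followed by \<open>w\<close>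
  is brought into normal form at the join; unless the words agree, a nonempty alternating word with
  product \<one> results.\<close>

lemma inj_on_word_product:
  assumes A: "subgroup A G" and B: "subgroup B G"
    and triv: "\<And>w. w \<in> alternating_words G A B \<Longrightarrow> word_product G w = \<one> \<Longrightarrow> w = []"
  shows "inj_on (word_product G) (alternating_words G A B)"
proof (rule inj_onI)
  fix v w
  assume "v \<in> alternating_words G A B" "w \<in> alternating_words G A B"
    "word_product G v = word_product G w"
  then show "v = w"
  proof (induction v arbitrary: w)
    case Nil
    then show ?case using triv[of w] by simp
  next
    case (Cons p v)
    let ?inv = "\<lambda>v. rev (map (apsnd (\<lambda>g. inv g)) v)"
    note car = alternating_words_syllables[OF _ subgroup.subset[OF A] subgroup.subset[OF B]]
    show ?case
    proof (cases w)
      case Nil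
      then show ?thesis using Cons.prems triv[of "p # v"] by simp
    next
      case w: (Cons q w')
      have pv: "v \<in> alternating_words G A B" "snd p \<in> carrier G" "snd p \<noteq> \<one>"
        "snd p \<in> (if fst p then A else B)" "v \<noteq> [] \<Longrightarrow> fst p \<noteq> fst (hd v)"
        using Cons.prems(1) car[OF Cons.prems(1)] by (auto simp: alternating_words_Cons)
      have qw: "w' \<in> alternating_words G A B" "snd q \<in> carrier G"
        "snd q \<in> (if fst q then A else B)" "w' \<noteq> [] \<Longrightarrow> fst q \<noteq> fst (hd w')"
        using Cons.prems(2) car[OF Cons.prems(2)] w by (auto simp: alternating_words_Cons)
      note cv = car[OF pv(1)] word_product_closed[OF car[OF pv(1)]]
      note cw = car[OF qw(1)] word_product_closed[OF car[OF qw(1)]]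
      note cinv = car[OF alternating_words_inverse[OF A B pv(1)]]
      have eq: "snd p \<otimes> word_product G v = snd q \<otimes> word_product G w'"
        using Cons.prems(3) w by simp
      have hd_inv: "fst (last (?inv v)) = fst (hd v)" if "v \<noteq> []"
        using that by (cases v) auto
      show ?thesis
      proof (cases "fst p = fst q")
        \<comment> \<open>The syllables at the join have different tags, so the concatenation is
          already alternating.\<close>
        case False
        let ?u = "?inv (p # v) @ w"
        have "?u \<in> alternating_words G A B"
          using alternating_words_inverse[OF A B Cons.prems(1)] Cons.prems(2) False w
          by (simp add: alternating_words_append alternating_words_Cons)
        moreover have "word_product G ?u = \<one>"
          using word_product_append[OF car[OF alternating_words_inverse[OF A B Cons.prems(1)]]
              car[OF Cons.prems(2)]] word_product_inverse[OF car[OF Cons.prems(1)]] Cons.prems(3)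
            word_product_closed[OF car[OF Cons.prems(2)]] by simp
        ultimately show ?thesis using triv[of ?u] w by simp
      next
        case same: True
        show ?thesis
        proof (cases "snd p = snd q")
          case True
          then have "word_product G v = word_product G w'" using eq pv(2) cv cw by simp
          then show ?thesis using Cons.IH[OF pv(1) qw(1)] same True w by (simp add: prod_eq_iff)
        next
          \<comment> \<open>Equal tags but different syllables: the two merge into the single
            nontrivial syllable \<open>g\<close>.\<close>
          case False
          define g where "g = inv snd p \<otimes> snd q"
          let ?u = "?inv v @ (fst p, g) # w'"
          have "snd q = snd p \<otimes> g" unfolding g_def using pv(2) qw(2) by (simp add: m_assoc[symmetric])
          then have g1: "g \<noteq> \<one>" "g \<in> carrier G" using False pv(2) qw(2) by (auto simp: g_def)
          have "g \<in> (if fst p then A else B)"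
            unfolding g_def using pv(4) qw(3) same A B
            by (auto intro!: subgroup.m_closed subgroup.m_inv_closed)
          then have "?u \<in> alternating_words G A B"
            using alternating_words_inverse[OF A B pv(1)] pv(5) qw same g1 hd_inv
            by (auto simp: alternating_words_append alternating_words_Cons)
          moreover have "word_product G ?u = inv (word_product G v) \<otimes> (g \<otimes> word_product G w')"
            using cinv cw g1 by (subst word_product_append) (auto simp: word_product_inverse[OF cv(1)])
          moreover have "g \<otimes> word_product G w' = word_product G v"
            unfolding g_def using eq pv(2) qw(2) cv cw by (simp add: m_assoc eq[symmetric] inv_mult_cancel)
          ultimately show ?thesis using triv[of ?u] cv by simp
        qed
      qed
    qed
  qed
qed

lemma internal_free_product_subset:
  assumes "internal_free_product G L A B"
  shows "A \<subseteq> L" "B \<subseteq> L"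
proof -
  have sub: "subgroup L G" "subgroup A G" "subgroup B G"
    and im: "word_product G ` alternating_words G A B = L"
    using assms by (auto simp: internal_free_product_def bij_betw_def)
  have syllable: "g \<in> L" if g: "g \<in> (if t then A else B)" for t g
  proof (cases "g = \<one>")
    case False
    then have "[(t, g)] \<in> alternating_words G A B" using g by (simp add: alternating_words_Cons)
    moreover have "g \<in> carrier G" using g sub subgroup.mem_carrier by (metis (full_types))
    ultimately show ?thesis using im by force
  qed (use sub in \<open>simp add: subgroup.one_closed\<close>)
  show "A \<subseteq> L" "B \<subseteq> L" using syllable[of _ True] syllable[of _ False] by auto
qed

text \<open>A common nontrivial element would be the product of two one-syllable words that differ
  in their tags.\<close>

lemma internal_free_product_Int:
  assumes "internal_free_product G L A B" "g \<in> A" "g \<in> B"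
  shows "g = \<one>"
proof (rule ccontr)
  assume "g \<noteq> \<one>"
  then have "[(True, g)] \<in> alternating_words G A B" "[(False, g)] \<in> alternating_words G A B"
    using assms by (auto simp: alternating_words_Cons)
  moreover have "inj_on (word_product G) (alternating_words G A B)"
    using assms by (simp add: internal_free_product_def bij_betw_def)
  ultimately show False
    using inj_onD[of "word_product G" _ "[(True, g)]" "[(False, g)]"] by fastforce
qed

lemma internal_free_product_trivial_right:
  assumes "internal_free_product G L A {\<one>}"
  shows "L = A"
proof
  have A: "subgroup A G" and im: "word_product G ` alternating_words G A {\<one>} = L"
    using assms by (auto simp: internal_free_product_def bij_betw_def)
  have "word_product G w \<in> A" if "w \<in> alternating_words G A {\<one>}" for w
    using alternating_words_syllables[OF that] A
    by (intro word_product_in_subgroup) (auto simp: subgroup.one_closed)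
  then show "L \<subseteq> A" using im by auto
qed (rule internal_free_product_subset[OF assms])

end

text \<open>Cut the word into blocks of letters from one alphabet, a letter of both counting as one
  of \<open>S\<close>. The ambient free group supplies only the unit \<open>[]\<close>, so
  nontrivial syllables are nonempty blocks.\<close>

lemma words_block_decomposition:
  assumes "w \<in> words (S \<union> U)"
  shows "\<exists>bs \<in> alternating_words (free_group (S \<union> U)) (words S) (words U). concat (map snd bs) = w"
  using assms
proof (induction w)
  case (Cons a w)
  define t where "t = (fst a \<in> S)"
  have a: "fst a \<in> (if t then S else U)" using Cons.prems by (auto simp: t_def words_iff)
  have w: "w \<in> words (S \<union> U)" "w \<noteq> [] \<Longrightarrow> hd w \<noteq> inv_letter a"
    using Cons.prems by (auto simp: words_iff freely_reduced_def successively_Cons)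
  from Cons.IH[OF w(1)] obtain bs
    where bs: "bs \<in> alternating_words (free_group (S \<union> U)) (words S) (words U)"
      "concat (map snd bs) = w" by blast
  show ?case
  proof (cases "bs \<noteq> [] \<and> fst (hd bs) = t")
    case False
    then have "(t, [a]) # bs \<in> alternating_words (free_group (S \<union> U)) (words S) (words U)"
      using bs a by (cases a) (auto simp: alternating_words_Cons words_iff one_free_group)
    then show ?thesis using bs(2) by (intro bexI[of _ "(t, [a]) # bs"]) auto
  next
    case True
    then obtain u cs where cs: "bs = (t, u) # cs" by (cases bs) auto
    then have u: "u \<in> words (if t then S else U)" "u \<noteq> []"
      using bs by (auto simp: alternating_words_Cons one_free_group)
    then have "a # u \<in> words (if t then S else U)"
      using a w(2) bs(2) cs by (cases a) (auto simp: words_iff freely_reduced_def successively_Cons)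
    then have "(t, a # u) # cs \<in> alternating_words (free_group (S \<union> U)) (words S) (words U)"
      using bs(1) cs by (auto simp: alternating_words_Cons one_free_group)
    then show ?thesis using bs(2) cs by (intro bexI[of _ "(t, a # u) # cs"]) auto
  qed
qed (auto intro!: bexI[of _ "[]"])

text \<open>Neighbouring blocks use disjoint alphabets, so nothing cancels where they meet.\<close>

lemma concat_blocks_in_words:
  assumes "S \<inter> U = {}" "bs \<in> alternating_words (free_group (S \<union> U)) (words S) (words U)"
  shows "concat (map snd bs) \<in> words (S \<union> U)"
  using assms(2)
proof (induction bs)
  case Nil
  then show ?case by (simp add: words_iff)
next
  case (Cons p bs)
  let ?w = "concat (map snd bs)"
  have p: "snd p \<in> words (if fst p then S else U)" "snd p \<noteq> []"
    and bs: "bs \<in> alternating_words (free_group (S \<union> U)) (words S) (words U)"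
      "bs \<noteq> [] \<Longrightarrow> fst p \<noteq> fst (hd bs)"
    using Cons.prems by (auto simp: alternating_words_Cons one_free_group)
  have "hd ?w \<noteq> inv_letter (last (snd p))" if "?w \<noteq> []"
  proof -
    have "bs \<noteq> []" using that by auto
    then obtain q cs where q: "bs = q # cs" by (cases bs) auto
    then have "snd q \<in> words (if fst q then S else U)" "snd q \<noteq> []" "fst q \<noteq> fst p"
      using bs by (auto simp: alternating_words_Cons one_free_group)
    then have "hd ?w \<in> (if fst q then S else U) \<times> UNIV"
      using hd_in_set[of "snd q"] q 
        subsetD[of "set (snd q)" _ "hd (snd q)"] by (simp add: words_iff)
    then have "fst (hd ?w) \<in> (if fst q then S else U)" by (simp only: mem_Times_iff)
    moreover have "last (snd p) \<in> (if fst p then S else U) \<times> UNIV"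
      using p last_in_set[of "snd p"] subsetD[of "set (snd p)" _ "last (snd p)"]
      by (simp add: words_iff)
    then have "fst (last (snd p)) \<in> (if fst p then S else U)" by (simp only: mem_Times_iff)
    ultimately have "fst (hd ?w) \<noteq> fst (last (snd p))"
      using assms(1) \<open>fst q \<noteq> fst p\<close> by (auto split: if_splits)
    then show ?thesis by (metis fst_inv_letter)
  qed
  moreover have "set (snd p) \<subseteq> (S \<union> U) \<times> UNIV" "freely_reduced (snd p)"
    using p by (auto simp: words_iff split: if_splits)
  ultimately show ?case
    using Cons.IH[OF bs(1)] p(2)
    by (auto simp: words_iff freely_reduced_def successively_append_iff)
qed

section \<open>Free products as disjoint unions of bases\<close>

context group
begin

lemma word_product_eval_blocks:
  assumes "f ` Y \<subseteq> carrier G" "\<forall>u \<in> snd ` set bs. set u \<subseteq> Y \<times> UNIV"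
  shows "word_product G (map (apsnd (eval_word G f)) bs) = eval_word G f (concat (map snd bs))"
  using assms(2)
proof (induction bs)
  case (Cons p bs)
  then have p: "set (snd p) \<subseteq> Y \<times> UNIV" and bs: "\<forall>u \<in> snd ` set bs. set u \<subseteq> Y \<times> UNIV"
    by simp_all
  then have "set (concat (map snd bs)) \<subseteq> Y \<times> UNIV" by (simp add: UN_subset_iff)
  then show ?case using Cons.IH[OF bs] eval_word_append[OF assms(1) p] by simp
qed simp

text \<open>Alternating words over the two spanned subgroups correspond to block decompositions of
  reduced words in \<open>S \<union> U\<close>; evaluation is bijective on the latter because
  \<open>S \<union> U\<close> indexes a basis.\<close>

lemma internal_free_product_of_basis:
  assumes basis: "free_basis G f (S \<union> U) L" and disj: "S \<inter> U = {}"
  shows "internal_free_product G L (eval_word G f ` words S) (eval_word G f ` words U)"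
proof -
  let ?A = "eval_word G f ` words S" and ?B = "eval_word G f ` words U"
  let ?blocks = "alternating_words (free_group (S \<union> U)) (words S) (words U)"
  let ?ev = "map (apsnd (eval_word G f))"
  have f: "f ` (S \<union> U) \<subseteq> carrier G" "f ` S \<subseteq> carrier G" "f ` U \<subseteq> carrier G"
    using free_basis_carrier[OF basis] by auto
  have sub: "subgroup ?A G" "subgroup ?B G" using subgroup_eval_word_image f by auto
  have L: "L = eval_word G f ` words (S \<union> U)" "subgroup L G"
    using free_basis_image[OF basis] free_basis_subgroup[OF basis] by auto
  have AB: "?A \<subseteq> L" "?B \<subseteq> L"
    unfolding L(1) by (intro image_mono words_mono; simp)+
  have prod: "word_product G (?ev bs) = eval_word G f (concat (map snd bs))" if "bs \<in> ?blocks" for bs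
  proof (rule word_product_eval_blocks[OF f(1)], rule ballI)
    fix u assume "u \<in> snd ` set bs"
    then have "u \<in> words (S \<union> U)"
      using group.alternating_words_syllables[OF group_free_group that words_mono words_mono] by auto
    then show "set u \<subseteq> (S \<union> U) \<times> UNIV" by (simp add: words_iff)
  qed
  \<comment> \<open>A word is chosen for each syllable; it is nonempty because the syllable is not
    \<one>.\<close>
  have pre: "\<exists>bs \<in> ?blocks. v = ?ev bs" if "v \<in> alternating_words G ?A ?B" for v
    using that
  proof (induction v)
    case (Cons p v)
    then obtain bs where bs: "bs \<in> ?blocks" "v = ?ev bs" by (auto simp: alternating_words_Cons)
    have "snd p \<in> eval_word G f ` (if fst p then words S else words U)"
      using Cons.prems by (auto simp: alternating_words_Cons split: if_splits)
    then obtain u where u: "u \<in> (if fst p then words S else words U)" "snd p = eval_word G f u" by blast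
    have "u \<noteq> []" using u Cons.prems by (auto simp: alternating_words_Cons)
    moreover have "bs \<noteq> [] \<longrightarrow> fst p \<noteq> fst (hd bs)"
      using Cons.prems bs(2) by (cases bs) (auto simp: alternating_words_Cons)
    ultimately have "(fst p, u) # bs \<in> ?blocks"
      using u(1) bs(1) by (auto simp: alternating_words_Cons one_free_group)
    moreover have "p # v = ?ev ((fst p, u) # bs)" using u bs by (cases p) simp
    ultimately show ?case by (rule bexI[rotated])
  qed (auto intro!: bexI[of _ "[]"])
  have "v = []" if v: "v \<in> alternating_words G ?A ?B" "word_product G v = \<one>" for v
  proof -
    obtain bs where bs: "bs \<in> ?blocks" "v = ?ev bs" using pre[OF v(1)] by blast
    then have "concat (map snd bs) = []"
      using free_basis_trivial[OF basis concat_blocks_in_words[OF disj bs(1)]] prod v(2) by simp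
    then show ?thesis using bs by (cases bs) (auto simp: alternating_words_Cons one_free_group)
  qed
  then have inj: "inj_on (word_product G) (alternating_words G ?A ?B)"
    by (rule inj_on_word_product[OF sub])
  have "word_product G ` alternating_words G ?A ?B = L"
  proof (rule equalityI; rule subsetI)
    fix g assume "g \<in> word_product G ` alternating_words G ?A ?B"
    then show "g \<in> L"
      using word_product_in_subgroup[OF L(2)] alternating_words_syllables[OF _ AB] by blast
  next
    fix g assume "g \<in> L"
    then obtain w where w: "w \<in> words (S \<union> U)" "g = eval_word G f w" using L by blast
    then obtain bs where bs: "bs \<in> ?blocks" "concat (map snd bs) = w"
      using words_block_decomposition by blast
    have ne: "eval_word G f u \<noteq> \<one>" if "u \<in> words S \<union> words U" "u \<noteq> []" for u
      using free_basis_trivial[OF basis, of u] that words_mono[of S "S \<union> U"] words_mono[of U "S \<union> U"]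
      by blast
    have "?ev bs \<in> alternating_words G ?A ?B"
      using bs(1)
    proof (induction bs)
      case (Cons p bs)
      have "fst (hd (?ev bs)) = fst (hd bs)" if "bs \<noteq> []" using that by (cases bs) auto
      then show ?case
        using Cons ne[of "snd p"] by (auto simp: alternating_words_Cons one_free_group)
    qed simp
    moreover have "word_product G (?ev bs) = g" using prod[OF bs(1)] bs w by simp
    ultimately show "g \<in> word_product G ` alternating_words G ?A ?B" by force
  qed
  with inj sub L(2) show ?thesis by (simp add: internal_free_product_def bij_betw_def)
qed

text \<open>The converse passage. A common basis element would lie in both factors, hence be \<one>,
  which no basis contains. A relation cut into blocks evaluates to an alternating word with product
  \<one>, so there are no blocks.\<close>

lemma free_basis_Un:
  assumes prod: "internal_free_product G L A B"
    and S: "free_basis G (\<lambda>x. x) S A" and U: "free_basis G (\<lambda>x. x) U B"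
  shows "S \<inter> U = {}" "free_basis G (\<lambda>x. x) (S \<union> U) L"
proof -
  let ?blocks = "alternating_words (free_group (S \<union> U)) (words S) (words U)"
  let ?ev = "map (apsnd (eval_word G (\<lambda>x. x)))"
  have sub: "subgroup L G" "subgroup A G" "subgroup B G"
    and inj: "inj_on (word_product G) (alternating_words G A B)"
    and im: "word_product G ` alternating_words G A B = L"
    using prod by (auto simp: internal_free_product_def bij_betw_def)
  have car: "(\<lambda>x. x) ` (S \<union> U) \<subseteq> carrier G" using free_basis_carrier[OF S] free_basis_carrier[OF U] by auto
  show "S \<inter> U = {}"
  proof (rule ccontr)
    assume "S \<inter> U \<noteq> {}"
    then obtain s where s: "s \<in> S" "s \<in> U" by auto
    then have "s = \<one>"
      using internal_free_product_Int[OF prod] free_basis_generators[OF S] free_basis_generators[OF U]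
      by auto
    then have "eval_word G (\<lambda>x. x) [(s, True)] = \<one>" by (simp add: letter_value_def)
    then show False using free_basis_trivial[OF S, of "[(s, True)]"] s by (simp add: words_iff)
  qed
  have img: "A = eval_word G (\<lambda>x. x) ` words S" "B = eval_word G (\<lambda>x. x) ` words U"
    using free_basis_image S U by auto
  show "free_basis G (\<lambda>x. x) (S \<union> U) L"
  proof (rule free_basisI[OF car])
    have AB: "(\<lambda>x. x) ` (S \<union> U) \<subseteq> L"
      using free_basis_generators[OF S] free_basis_generators[OF U] internal_free_product_subset[OF prod]
      by auto
    let ?E = "eval_word G (\<lambda>x. x) ` words (S \<union> U)"
    have "?E \<subseteq> L" using eval_word_in_subgroup[OF sub(1) AB] by (auto simp: words_iff)
    moreover have "A \<subseteq> ?E" "B \<subseteq> ?E" unfolding img by (intro image_mono words_mono; simp)+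
    then have "L \<subseteq> ?E"
      unfolding im[symmetric]
      using word_product_in_subgroup[OF subgroup_eval_word_image[OF car]] alternating_words_syllables
      by blast
    ultimately show "?E = L" by blast
  next
    fix w assume w: "w \<in> words (S \<union> U)" "eval_word G (\<lambda>x. x) w = \<one>"
    then obtain bs where bs: "bs \<in> ?blocks" "concat (map snd bs) = w"
      using words_block_decomposition by blast
    have "?ev bs \<in> alternating_words G A B"
      using bs(1)
    proof (induction bs)
      case (Cons p bs)
      have "fst (hd (?ev bs)) = fst (hd bs)" if "bs \<noteq> []" using that by (cases bs) auto
      then show ?case
        using Cons free_basis_trivial[OF S, of "snd p"] free_basis_trivial[OF U, of "snd p"] img
        by (auto simp: alternating_words_Cons one_free_group split: if_splits)
    qed simp
    moreover have "word_product G (?ev bs) = eval_word G (\<lambda>x. x) (concat (map snd bs))"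
    proof (rule word_product_eval_blocks[OF car], rule ballI)
      fix u assume "u \<in> snd ` set bs"
      then have "u \<in> words (S \<union> U)"
        using group.alternating_words_syllables[OF group_free_group bs(1) words_mono words_mono] by auto
      then show "set u \<subseteq> (S \<union> U) \<times> UNIV" by (simp add: words_iff)
    qed
    ultimately have "?ev bs = []" using inj_onD[OF inj, of "?ev bs" "[]"] bs w by simp
    then show "w = []" using bs by simp
  qed
qed

end

section \<open>Rank\<close>

text \<open>The homomorphism to the group of order two, with \<noteq> on truth values as its
  operation, that is nontrivial exactly on the generators in \<open>P\<close>. A letter and its
  inverse count alike, so cancellation preserves the parity.\<close>

definition letter_parity :: "'y set \<Rightarrow> 'y word \<Rightarrow> bool"
  where "letter_parity P w = odd (length (filter (\<lambda>a. fst a \<in> P) w))"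

lemma letter_parity_foldr_push:
  "letter_parity P (foldr push_letter u v) = (letter_parity P u \<noteq> letter_parity P v)"
proof (induction u)
  case (Cons a u)
  have "letter_parity P (push_letter a w) = ((fst a \<in> P) \<noteq> letter_parity P w)" for w
    by (cases w) (auto simp: letter_parity_def)
  then show ?case using Cons by (auto simp: letter_parity_def)
qed (simp add: letter_parity_def)

text \<open>A basis \<open>B\<close> gives \<open>2 ^ card B\<close> homomorphisms to the group of order two, and a homomorphism
  is determined by its values on \<open>Y\<close>.\<close>

lemma (in group) free_basis_card_le:
  assumes Y: "free_basis G f Y A" "finite Y" and B: "free_basis G h B A"
  shows "finite B" "card B \<le> card Y"
proof -
  \<comment> \<open>The parity homomorphism of \<open>P\<close>, carried over to \<open>A\<close> by
    writing elements as words in the basis \<open>B\<close>.\<close>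
  define c where "c P g = letter_parity P (inv_into (words B) (eval_word G h) g)" for P g
  have A: "subgroup A G" "A \<subseteq> carrier G" using free_basis_subgroup[OF B] subgroup.subset by auto
  have img: "A = eval_word G h ` words B" using free_basis_image[OF B] .
  have c_eval: "c P (eval_word G h w) = letter_parity P w" if "w \<in> words B" for P w
    unfolding c_def using inv_into_f_f[OF free_basis_inj[OF B] that] by simp
  have c_mult: "c P (x \<otimes> y) = (c P x \<noteq> c P y)" if xy: "x \<in> A" "y \<in> A" for P x y
  proof -
    obtain u v where uv: "u \<in> words B" "v \<in> words B" "x = eval_word G h u" "y = eval_word G h v"
      using xy img by blast
    then have "foldr push_letter u v \<in> words B"
      using foldr_push_in_words[of u B v] by (simp add: words_iff)
    moreover have "x \<otimes> y = eval_word G h (foldr push_letter u v)"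
      using eval_word_foldr_push[OF free_basis_carrier[OF B]] uv by (simp add: words_iff)
    ultimately show ?thesis using uv by (simp add: c_eval letter_parity_foldr_push)
  qed
  have c_one: "\<not> c P \<one>" for P using c_mult[of \<one> \<one> P] A(1) by (simp add: subgroup.one_closed)
  have c_inv: "c P (inv x) = c P x" if "x \<in> A" for P x
    using c_mult[of "inv x" x P] c_one[of P] that A by (auto simp: subgroup.m_inv_closed)
  define \<Phi> where "\<Phi> P = {y \<in> Y. c P (f y)}" for P
  have "inj_on \<Phi> (Pow B)"
  proof (rule inj_onI)
    fix P Q assume PQ: "P \<in> Pow B" "Q \<in> Pow B" "\<Phi> P = \<Phi> Q"
    note fA = free_basis_generators[OF Y(1)]
    have "c P (eval_word G f w) = c Q (eval_word G f w)" if "set w \<subseteq> Y \<times> UNIV" for w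
      using that
    proof (induction w)
      case (Cons a w)
      then have a: "fst a \<in> Y" "set w \<subseteq> Y \<times> UNIV" by auto
      have "f (fst a) \<in> A" using a fA by auto
      moreover have "c P (f (fst a)) = c Q (f (fst a))" using PQ(3) a by (auto simp: \<Phi>_def)
      ultimately have "c P (letter_value G f a) = c Q (letter_value G f a)"
        by (simp add: letter_value_def c_inv)
      then show ?case
        using Cons.IH[OF a(2)] eval_word_in_subgroup[OF A(1) fA a(2)]
          letter_value_in_subgroup[OF A(1) fA a(1)] by (simp add: c_mult)
    qed (simp add: c_one)
    then have eq: "c P g = c Q g" if "g \<in> A" for g
      using that free_basis_image[OF Y(1)] by (auto simp: words_iff)
    have "b \<in> P \<longleftrightarrow> b \<in> Q" if b: "b \<in> B" for b
    proof -
      have w: "[(b, True)] \<in> words B" using b by (simp add: words_iff)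
      then show ?thesis
        using eq[of "eval_word G h [(b, True)]"] img unfolding c_eval[OF w]
        by (simp add: c_eval[OF w] letter_parity_def del: eval_word_Cons split: if_splits)
    qed
    then show "P = Q" using PQ by blast
  qed
  moreover have "\<Phi> ` Pow B \<subseteq> Pow Y" by (auto simp: \<Phi>_def)
  moreover have "finite (Pow Y)" using Y(2) by simp
  ultimately have fin: "finite (Pow B)" and le: "card (Pow B) \<le> card (Pow Y)"
    by (rule inj_on_finite, rule card_inj_on_le)
  from fin show "finite B" by simp
  with le Y(2) show "card B \<le> card Y" by (simp add: card_Pow)
qed

section \<open>Free factors and algebraic extensions\<close>

text \<open>With the empty set of letters, the larger of the two bases is an ordinary Schreier
  basis.\<close>

lemma Nielsen_Schreier:
  assumes "subgroup H (free_group X)"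
  shows "\<exists>B. free_basis (free_group X) (\<lambda>x. x) B H"
  using group.relative_Schreier_basis[OF group_free_group free_basis_free_group assms, of "{}"] by blast

text \<open>Bases of the factor and of its complement together form a basis of F(X). This puts a
  free factor into the form that the relative Schreier basis requires.\<close>

lemma free_factor_basis_subset:
  assumes "internal_free_product (free_group X) (words X) L C"
  obtains S Y where "S \<subseteq> Y" "free_basis (free_group X) (\<lambda>x. x) Y (words X)"
    "L = eval_word (free_group X) (\<lambda>x. x) ` words S"
proof -
  interpret F: group "free_group X" by (rule group_free_group)
  have sub: "subgroup L (free_group X)" "subgroup C (free_group X)"
    using assms by (auto simp: internal_free_product_def)
  obtain S U where SU: "free_basis (free_group X) (\<lambda>x. x) S L" "free_basis (free_group X) (\<lambda>x. x) U C"
    using Nielsen_Schreier[OF sub(1)] Nielsen_Schreier[OF sub(2)] by blast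
  show thesis using that[OF Un_upper1 F.free_basis_Un(2)[OF assms SU] F.free_basis_image[OF SU(1)]] .
qed

text \<open>The complement is spanned by the Schreier generators of \<open>H\<close> left over after
  a basis of \<open>H \<inter> L\<close> is taken out.\<close>

lemma free_factor_Int_subgroup:
  assumes "internal_free_product (free_group X) (words X) L C" "subgroup H (free_group X)"
  shows "\<exists>D. subgroup D (free_group X) \<and> internal_free_product (free_group X) H (H \<inter> L) D"
proof -
  interpret F: group "free_group X" by (rule group_free_group)
  obtain S Y where SY: "S \<subseteq> Y" "free_basis (free_group X) (\<lambda>x. x) Y (words X)"
    "L = eval_word (free_group X) (\<lambda>x. x) ` words S"
    by (rule free_factor_basis_subset[OF assms(1)])
  obtain B B0 where B: "B0 \<subseteq> B" "free_basis (free_group X) (\<lambda>x. x) B H"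
    "free_basis (free_group X) (\<lambda>x. x) B0 (H \<inter> L)"
    using F.relative_Schreier_basis[OF SY(2) assms(2) SY(1)] SY(3) by auto
  have "B0 \<union> (B - B0) = B" using B(1) by auto
  then have "internal_free_product (free_group X) H (H \<inter> L)
      (eval_word (free_group X) (\<lambda>x. x) ` words (B - B0))"
    using F.internal_free_product_of_basis[of "\<lambda>x. x" B0 "B - B0" H] B F.free_basis_image[OF B(3)] by auto
  then show ?thesis by (auto simp: internal_free_product_def)
qed

text \<open>The bases of the three factors form a basis of F(X), which is regrouped so that
  \<open>D\<close> joins the complement.\<close>

lemma free_factor_trans:
  assumes "internal_free_product (free_group X) (words X) L C"
    and "internal_free_product (free_group X) L M D"
  shows "free_factor (free_group X) M"
proof -
  interpret F: group "free_group X" by (rule group_free_group)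
  have sub: "subgroup M (free_group X)" "subgroup D (free_group X)" "subgroup C (free_group X)"
    using assms by (auto simp: internal_free_product_def)
  obtain S T U where b: "free_basis (free_group X) (\<lambda>x. x) S M"
    "free_basis (free_group X) (\<lambda>x. x) T D" "free_basis (free_group X) (\<lambda>x. x) U C"
    using Nielsen_Schreier[OF sub(1)] Nielsen_Schreier[OF sub(2)] Nielsen_Schreier[OF sub(3)] by blast
  note ST = F.free_basis_Un[OF assms(2) b(1,2)]
  note STU = F.free_basis_Un[OF assms(1) ST(2) b(3)]
  have "free_basis (free_group X) (\<lambda>x. x) (S \<union> (T \<union> U)) (words X)" "S \<inter> (T \<union> U) = {}"
    using ST(1) STU by (auto simp: Un_assoc)
  from F.internal_free_product_of_basis[OF this] show ?thesis
    unfolding free_factor_def F.free_basis_image[OF b(1), symmetric]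
    by (auto simp: internal_free_product_def)
qed

lemma free_factor_carrier: "free_factor (free_group X) (words X)"
proof -
  interpret F: group "free_group X" by (rule group_free_group)
  obtain B where B: "free_basis (free_group X) (\<lambda>x. x) B (words X)"
    using Nielsen_Schreier[OF F.subgroup_self] by blast
  then have "internal_free_product (free_group X) (words X) (words X)
      (eval_word (free_group X) (\<lambda>x. x) ` words {})"
    using F.internal_free_product_of_basis[of "\<lambda>x. x" B "{}" "words X"] F.free_basis_image[OF B] by auto
  then show ?thesis by (auto simp: free_factor_def internal_free_product_def)
qed

lemma algebraic_extension_subset_free_factor:
  assumes "algebraic_extension (free_group X) K H" "free_factor (free_group X) L" "K \<subseteq> L"
  shows "H \<subseteq> L"
proof -
  interpret F: group "free_group X" by (rule group_free_group)
  have H: "subgroup K (free_group X)" "subgroup H (free_group X)" "K \<subseteq> H"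
    "\<not> free_extension (free_group X) K H"
    using assms(1) by (auto simp: algebraic_extension_def)
  obtain C where "internal_free_product (free_group X) (words X) L C"
    using assms(2) by (auto simp: free_factor_def)
  then obtain D where D: "subgroup D (free_group X)" "internal_free_product (free_group X) H (H \<inter> L) D"
    using free_factor_Int_subgroup[OF _ H(2)] by blast
  moreover have "subgroup (H \<inter> L) (free_group X)" using D(2) by (simp add: internal_free_product_def)
  \<comment> \<open>\<open>K\<close> lies in \<open>H \<inter> L\<close>, so a nontrivial
    \<open>D\<close> would exhibit \<open>H\<close> as a free extension of \<open>K\<close>.\<close>
  ultimately have "D = {\<one>\<^bsub>free_group X\<^esub>}"
    using H assms(3) unfolding free_extension_def by blast
  then have "H = H \<inter> L" using D(2) F.internal_free_product_trivial_right by blast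
  then show ?thesis by blast
qed

lemma algebraic_extension_free_factor_exists:
  assumes X: "finite X" and K: "subgroup K (free_group X)"
  shows "\<exists>L. free_factor (free_group X) L \<and> algebraic_extension (free_group X) K L"
proof -
  interpret F: group "free_group X" by (rule group_free_group)
  define P where "P n \<longleftrightarrow> (\<exists>L B. free_factor (free_group X) L \<and> K \<subseteq> L
    \<and> free_basis (free_group X) (\<lambda>x. x) B L \<and> finite B \<and> card B = n)" for n
  obtain B0 where B0: "free_basis (free_group X) (\<lambda>x. x) B0 (words X)"
    using Nielsen_Schreier[OF F.subgroup_self] by blast
  \<comment> \<open>Finiteness of \<open>X\<close> ensures that some finite rank occurs: F(X) is a
    free factor of itself containing \<open>K\<close>.\<close>
  have "finite B0" by (rule F.free_basis_card_le(1)[OF free_basis_free_group X B0])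
  then have "P (card B0)"
    unfolding P_def using free_factor_carrier B0 subgroup.subset[OF K] by blast
  then have "P (LEAST n. P n)" by (rule LeastI)
  then obtain L B where L: "free_factor (free_group X) L" "K \<subseteq> L"
    "free_basis (free_group X) (\<lambda>x. x) B L" "finite B" "card B = (LEAST n. P n)"
    unfolding P_def by blast
  have "\<not> free_extension (free_group X) K L"
  proof
    assume "free_extension (free_group X) K L"
    then obtain C M where CM: "subgroup C (free_group X)" "subgroup M (free_group X)"
      "C \<noteq> {\<one>\<^bsub>free_group X\<^esub>}" "K \<subseteq> M" "internal_free_product (free_group X) L M C"
      unfolding free_extension_def by blast
    obtain S U where SU: "free_basis (free_group X) (\<lambda>x. x) S M" "free_basis (free_group X) (\<lambda>x. x) U C"
      using Nielsen_Schreier[OF CM(1)] Nielsen_Schreier[OF CM(2)] by blast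
    note un = F.free_basis_Un[OF CM(5) SU]
    \<comment> \<open>\<open>S \<union> U\<close> is another basis of \<open>L\<close>, so it has at
      most \<open>card B\<close> elements; \<open>U\<close> is nonempty because \<open>C\<close> is
      nontrivial, and this makes the rank of \<open>M\<close> strictly smaller.\<close>
    note le = F.free_basis_card_le[OF L(3,4) un(2)]
    have "U \<noteq> {}"
    proof
      assume "U = {}"
      then have "words U = {[]}" by (auto simp: words_iff)
      then show False using CM(3) F.free_basis_image[OF SU(2)] by simp
    qed
    then have "card U > 0" "card (S \<union> U) = card S + card U"
      using le(1) un(1) by (auto simp: card_gt_0_iff card_Un_disjoint)
    then have "card S < card B" using le(2) by simp
    moreover have "free_factor (free_group X) M"
      using L(1) free_factor_trans[OF _ CM(5)] by (auto simp: free_factor_def)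
    then have "P (card S)" unfolding P_def using CM(4) SU(1) le(1) by blast
    ultimately show False using L(5) not_less_Least by metis
  qed
  then have "algebraic_extension (free_group X) K L"
    using K L(2) F.free_basis_subgroup[OF L(3)] by (simp add: algebraic_extension_def)
  with L(1) show ?thesis by blast
qed

theorem theorem11p10:
  fixes X :: "'x set" and K :: "'x word set"
  assumes "finite X"
    and "subgroup K (free_group X)"
    and "finitely_generated_subgroup (free_group X) K"
  shows "algebraically_closed (free_group X) K \<longleftrightarrow> free_factor (free_group X) K"
proof -
  obtain L where L: "free_factor (free_group X) L" "algebraic_extension (free_group X) K L"
    using algebraic_extension_free_factor_exists[OF assms(1,2)] by blast
  have KL: "K \<subseteq> L" using L(2) by (simp add: algebraic_extension_def)
  have "algebraic_closure (free_group X) K = L"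
    unfolding algebraic_closure_def
  proof (rule Greatest_equality)
    show "algebraic_extension (free_group X) K L" by (rule L(2))
    show "H \<subseteq> L" if "algebraic_extension (free_group X) K H" for H
      using algebraic_extension_subset_free_factor[OF that L(1) KL] .
  qed
  \<comment> \<open>Here \<open>K\<close> itself takes the role of the free factor that bounds all
    algebraic extensions, among them \<open>L\<close>.\<close>
  moreover have "K = L" if "free_factor (free_group X) K"
    using algebraic_extension_subset_free_factor[OF L(2) that] KL by blast
  ultimately show ?thesis using L(1) by (auto simp: algebraically_closed_def)
qed

end
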